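(* Let $f=f_0+f_1$ satisfy the standing assumptions (i)–(iv) of the context, and suppose that $f$ is a KL function. Let $\{x^{(k)}\}_{k\in\mathbb{N}}$ and $\{\lambda_k\}_{k\in\mathbb{N}}$ be the sequences generated by Algorithm VMILAn (see context) with $\tilde y^{(k)}=y^{(k)}$ for all $k\ge0$. If there exists a limit point $\bar x$ of $\{x^{(k)}\}_{k\in\mathbb{N}}$, then: (i) $\lim_{k\to\infty}f(x^{(k)})=f(\bar x)$; (ii) $\bar x$ is a stationary point for the problem $\min_{x\in\mathbb{R}^n}f(x)$; (iii) the sequence $\{x^{(k)}\}_{k\in\mathbb{N}}$ converges to $\bar x$ and has finite length, i.e. $\sum_{k=0}^{\infty}\|x^{(k+1)}-x^{(k)}\|<+\infty$.
   Context: Notation. $\mathbb{N}=\{0,1,2,\dots\}$, $\bar{\mathbb{R}}=\mathbb{R}\cup\{\pm\infty\}$; $\|\cdot\|$ is the Euclidean norm on $\mathbb{R}^n$; for a symmetric positive definite matrix $D$, $\|x\|_D=\sqrt{x^TDx}$. For $\mu\ge1$, $\mathcal{M}_\mu$ is the set of symmetric positive definite $n\times n$ matrices with all eigenvalues in $[1/\mu,\mu]$. A limit point of a sequence is the limit of a subsequence. Standing assumptions. (i) $f_1:\mathbb{R}^n\to\bar{\mathbb{R}}$ is proper, convex and lower semicontinuous. (ii) $f_0:\mathbb{R}^n\to\mathbb{R}$ is continuously differentiable on an open set $\Omega_0\supset\mathrm{dom}(f_1)$. (iii) $\nabla f_0$ is $L$-Lipschitz continuous on $\mathrm{dom}(f_1)$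 with $L>0$: $\|\nabla f_0(x)-\nabla f_0(y)\|\le L\|x-y\|$ for all $x,y\in\mathrm{dom}(f_1)$. (iv) $f=f_0+f_1$ is bounded from below. Subdifferentials. For $\Psi:\mathbb{R}^n\to\bar{\mathbb{R}}$ and $x\in\mathrm{dom}(\Psi)$, $\hat\partial\Psi(x)=\{v:\liminf_{y\to x,y\ne x}\frac{1}{\|x-y\|}(\Psi(y)-\Psi(x)-(y-x)^Tv)\ge0\}$ and $\partial\Psi(x)=\{v:\exists\, y^{(k)}\to x,\ \Psi(y^{(k)})\to\Psi(x),\ v^{(k)}\in\hat\partial\Psi(y^{(k)}),\ v^{(k)}\to v\}$. $\mathrm{dom}(\partial\Psi)=\{x\in\mathrm{dom}(\Psi):\partial\Psi(x)\neq\emptyset\}$. A point $x$ is stationary for $\Psi$ (equivalently for $\min\Psi$) if $x\in\mathrm{dom}(\Psi)$ and $0\in\partial\Psi(x)$. KL property. A proper lower semicontinuous $f:\mathbb{R}^n\to\bar{\mathbb{R}}$ has the KL property at $\bar z\in\mathrm{dom}(\partial f)$ if there exist $\upsilon\in(0,+\infty]$, a neighborhood $U$ of $\bar z$ and a continuous concave function $\phi:[0,\upsilon)\to[0,+\infty)$ such that $\phi(0)=0$, $\phi$ is $C^1$ on $(0,\upsilon)$, $\phi'(s)>0$ for all $s\in(0,\upsilon)$, and $\phi'(f(z)-f(\bar z))\,\mathrm{dist}(0,\partial f(z))\ge1$ for all $z\in U$ with $f(\bar z)<f(z)<f(\bar z)+\upsilon$, where $\mathrm{dist}(z,\Omega)=\inf_{x\in\Omega}\|x-z\|$.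 $f$ is a KL function if it has the KL property at every point of $\mathrm{dom}(\partial f)$. Algorithm VMILAn. Choose constants $0<\alpha_{\min}\le\alpha_{\max}$, $\mu\ge1$, $\delta,\beta\in(0,1)$, $\gamma\in[0,1]$, $\tau>0$ and $x^{(0)}\in\mathrm{dom}(f_1)$. For $k=0,1,2,\dots$: 1. Choose any $\alpha_k\in[\alpha_{\min},\alpha_{\max}]$ and $D_k\in\mathcal{M}_\mu$. 2. Let $h^{(k)}_\gamma(x)=\nabla f_0(x^{(k)})^T(x-x^{(k)})+\frac{\gamma}{2\alpha_k}\|x-x^{(k)}\|_{D_k}^2+f_1(x)-f_1(x^{(k)})$, let $h^{(k)}=h^{(k)}_1$ (i.e. with $\gamma=1$), and let $y^{(k)}=\arg\min_{x\in\mathbb{R}^n}h^{(k)}(x)$ (unique). Compute any $\tilde y^{(k)}$ such that $h^{(k)}(\tilde y^{(k)})-h^{(k)}(y^{(k)})\le-\frac{\tau}{2}h^{(k)}_\gamma(\tilde y^{(k)})$. 3. Set $d^{(k)}=\tilde y^{(k)}-x^{(k)}$. 4. Let $i_k$ be the smallest non-negative integer such that $f(x^{(k)}+\delta^{i_k}d^{(k)})\le f(x^{(k)})+\beta\delta^{i_k}h^{(k)}_\gamma(\tilde y^{(k)})$ and set $\lambda_k=\delta^{i_k}$. 5. Set $x^{(k+1)}=\tilde y^{(k)}$ if $f(\tilde y^{(k)})<f(x^{(k)}+\lambda_kd^{(k)})$, and $x^{(k+1)}=x^{(k)}+\lambda_kd^{(k)}$ otherwise. *)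

theory Defs
  imports "HOL-Analysis.Analysis"
begin

section \<open>Extended-real-valued functions\<close>

definition edom :: "('a \<Rightarrow> ereal) \<Rightarrow> 'a set" where
  "edom f = {x. f x < \<infinity>}"

definition proper_fun :: "('a \<Rightarrow> ereal) \<Rightarrow> bool" where
  "proper_fun f \<longleftrightarrow> (\<forall>x. f x \<noteq> -\<infinity>) \<and> edom f \<noteq> {}"

text \<open>Only used for proper functions, so that no sum of opposite infinities occurs; note that
  \<^term>\<open>0 * \<infinity> = (0 :: ereal)\<close>, so the cases \<^term>\<open>u = (0 :: real)\<close> and \<^term>\<open>v = (0 :: real)\<close>
  are harmless.\<close>

definition econvex_fun :: "('a::real_vector \<Rightarrow> ereal) \<Rightarrow> bool" where
  "econvex_fun f \<longleftrightarrow>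
     (\<forall>x y u v. 0 \<le> u \<and> 0 \<le> v \<and> u + v = 1 \<longrightarrow>
        f (u *\<^sub>R x + v *\<^sub>R y) \<le> ereal u * f x + ereal v * f y)"

definition lsc_fun :: "('a::topological_space \<Rightarrow> ereal) \<Rightarrow> bool" where
  "lsc_fun f \<longleftrightarrow> (\<forall>x. f x \<le> Liminf (at x) f)"


section \<open>Gradients and matrices\<close>

text \<open>Only meaningful at points where the function is differentiable.\<close>

definition grad :: "('a::real_inner \<Rightarrow> real) \<Rightarrow> 'a \<Rightarrow> 'a" where
  "grad f x = (THE g. GDERIV f x :> g)"

definition cont_differentiable_on :: "('a::real_inner \<Rightarrow> real) \<Rightarrow> 'a set \<Rightarrow> bool" where
  "cont_differentiable_on f S \<longleftrightarrow>
     (\<forall>x\<in>S. \<exists>g. GDERIV f x :> g) \<and> continuous_on S (grad f)"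

definition spd_matrix :: "real^'n^'n \<Rightarrow> bool" where
  "spd_matrix D \<longleftrightarrow> transpose D = D \<and> (\<forall>x. x \<noteq> 0 \<longrightarrow> 0 < x \<bullet> (D *v x))"

definition real_eigenvalue :: "real^'n^'n \<Rightarrow> real \<Rightarrow> bool" where
  "real_eigenvalue D c \<longleftrightarrow> (\<exists>v. v \<noteq> 0 \<and> D *v v = c *\<^sub>R v)"

text \<open>Real eigenvalues suffice, since all eigenvalues of a real symmetric matrix are real.\<close>

definition spd_bounded :: "real \<Rightarrow> (real^'n^'n) set" where
  "spd_bounded \<mu> = {D. spd_matrix D \<and> (\<forall>c. real_eigenvalue D c \<longrightarrow> 1 / \<mu> \<le> c \<and> c \<le> \<mu>)}"

definition norm_wrt :: "real^'n^'n \<Rightarrow> real^'n \<Rightarrow> real" where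
  "norm_wrt D x = sqrt (x \<bullet> (D *v x))"


section \<open>Subdifferentials and stationarity\<close>

definition frechet_subdiff :: "(real^'n \<Rightarrow> ereal) \<Rightarrow> real^'n \<Rightarrow> (real^'n) set" where
  "frechet_subdiff \<Psi> x =
     {v. x \<in> edom \<Psi> \<and>
         0 \<le> Liminf (at x) (\<lambda>y. ereal (1 / norm (x - y)) * (\<Psi> y - \<Psi> x - ereal ((y - x) \<bullet> v)))}"

definition limiting_subdiff :: "(real^'n \<Rightarrow> ereal) \<Rightarrow> real^'n \<Rightarrow> (real^'n) set" where
  "limiting_subdiff \<Psi> x =
     {v. x \<in> edom \<Psi> \<and>
         (\<exists>y w. y \<longlonglongrightarrow> x \<and> (\<lambda>k. \<Psi> (y k)) \<longlonglongrightarrow> \<Psi> x \<and>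
                (\<forall>k. w k \<in> frechet_subdiff \<Psi> (y k)) \<and> w \<longlonglongrightarrow> v)}"

definition dom_subdiff :: "(real^'n \<Rightarrow> ereal) \<Rightarrow> (real^'n) set" where
  "dom_subdiff \<Psi> = {x \<in> edom \<Psi>. limiting_subdiff \<Psi> x \<noteq> {}}"

definition stationary_point :: "(real^'n \<Rightarrow> ereal) \<Rightarrow> real^'n \<Rightarrow> bool" where
  "stationary_point \<Psi> x \<longleftrightarrow> x \<in> edom \<Psi> \<and> 0 \<in> limiting_subdiff \<Psi> x"


section \<open>The Kurdyka--Lojasiewicz property\<close>

text \<open>Unlike \<^const>\<open>infdist\<close>, which is 0 for the empty set, this is \<^term>\<open>\<infinity> :: ereal\<close> there.\<close>

definition set_edist :: "'a::real_normed_vector \<Rightarrow> 'a set \<Rightarrow> ereal" where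
  "set_edist z \<Omega> = (INF x\<in>\<Omega>. ereal (norm (x - z)))"

definition kl_property :: "(real^'n \<Rightarrow> ereal) \<Rightarrow> real^'n \<Rightarrow> bool" where
  "kl_property f zbar \<longleftrightarrow>
     zbar \<in> dom_subdiff f \<and>
     (\<exists>(\<upsilon>::ereal) U (\<phi>::real \<Rightarrow> real).
        0 < \<upsilon> \<and> zbar \<in> interior U \<and>
        continuous_on {s. 0 \<le> s \<and> ereal s < \<upsilon>} \<phi> \<and>
        concave_on {s. 0 \<le> s \<and> ereal s < \<upsilon>} \<phi> \<and>
        (\<forall>s. 0 \<le> s \<and> ereal s < \<upsilon> \<longrightarrow> 0 \<le> \<phi> s) \<and>
        \<phi> 0 = 0 \<and>
        \<phi> C1_differentiable_on {s. 0 < s \<and> ereal s < \<upsilon>} \<and>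
        (\<forall>s. 0 < s \<and> ereal s < \<upsilon> \<longrightarrow> 0 < deriv \<phi> s) \<and>
        (\<forall>z\<in>U. f zbar < f z \<and> f z < f zbar + \<upsilon> \<longrightarrow>
           1 \<le> ereal (deriv \<phi> (real_of_ereal (f z - f zbar))) * set_edist 0 (limiting_subdiff f z)))"

definition kl_function :: "(real^'n \<Rightarrow> ereal) \<Rightarrow> bool" where
  "kl_function f \<longleftrightarrow> proper_fun f \<and> lsc_fun f \<and> (\<forall>z\<in>dom_subdiff f. kl_property f z)"


section \<open>The algorithm\<close>

definition objective :: "('a \<Rightarrow> real) \<Rightarrow> ('a \<Rightarrow> ereal) \<Rightarrow> 'a \<Rightarrow> ereal" where
  "objective f0 f1 x = ereal (f0 x) + f1 x"

definition h_model ::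
  "(real^'n \<Rightarrow> real) \<Rightarrow> (real^'n \<Rightarrow> ereal) \<Rightarrow> real \<Rightarrow> real^'n^'n \<Rightarrow> real^'n \<Rightarrow> real \<Rightarrow> real^'n \<Rightarrow> ereal"
where
  "h_model f0 f1 \<alpha> D xk \<gamma> x =
     ereal (grad f0 xk \<bullet> (x - xk) + \<gamma> / (2 * \<alpha>) * (norm_wrt D (x - xk))\<^sup>2) + f1 x - f1 xk"

definition armijo ::
  "(real^'n \<Rightarrow> ereal) \<Rightarrow> real \<Rightarrow> real \<Rightarrow> real^'n \<Rightarrow> real^'n \<Rightarrow> ereal \<Rightarrow> nat \<Rightarrow> bool"
where
  "armijo f \<delta> \<beta> xk dk hk j \<longleftrightarrow> f (xk + \<delta> ^ j *\<^sub>R dk) \<le> f xk + ereal (\<beta> * \<delta> ^ j) * hk"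

text \<open>The sequences below are produced by a run of the algorithm. All choices left to the user
  (the starting point, the step lengths, the scaling matrices and the inexact minimisers \<open>yt\<close>)
  are unconstrained apart from the stated conditions.\<close>

definition vmilan_run ::
  "(real^'n \<Rightarrow> real) \<Rightarrow> (real^'n \<Rightarrow> ereal) \<Rightarrow>
   real \<Rightarrow> real \<Rightarrow> real \<Rightarrow> real \<Rightarrow> real \<Rightarrow> real \<Rightarrow> real \<Rightarrow>
   (nat \<Rightarrow> real^'n) \<Rightarrow> (nat \<Rightarrow> real) \<Rightarrow> (nat \<Rightarrow> real^'n^'n) \<Rightarrow>
   (nat \<Rightarrow> real^'n) \<Rightarrow> (nat \<Rightarrow> real^'n) \<Rightarrow> (nat \<Rightarrow> real^'n) \<Rightarrow>
   (nat \<Rightarrow> nat) \<Rightarrow> (nat \<Rightarrow> real) \<Rightarrow> bool"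
where
  "vmilan_run f0 f1 \<alpha>min \<alpha>max \<mu> \<delta> \<beta> \<gamma> \<tau> x \<alpha> D y yt d i lam \<longleftrightarrow>
     x 0 \<in> edom f1 \<and>
     (\<forall>k. let f = objective f0 f1;
              h = h_model f0 f1 (\<alpha> k) (D k) (x k) 1;
              h\<gamma> = h_model f0 f1 (\<alpha> k) (D k) (x k) \<gamma>
          in \<alpha> k \<in> {\<alpha>min..\<alpha>max} \<and> D k \<in> spd_bounded \<mu> \<and>
             is_arg_min h (\<lambda>_. True) (y k) \<and>
             h (yt k) - h (y k) \<le> ereal (- (\<tau> / 2)) * h\<gamma> (yt k) \<and>
             d k = yt k - x k \<and>
             armijo f \<delta> \<beta> (x k) (d k) (h\<gamma> (yt k)) (i k) \<and>
             (\<forall>j<i k. \<not> armijo f \<delta> \<beta> (x k) (d k) (h\<gamma> (yt k)) j) \<and>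
             lam k = \<delta> ^ i k \<and>
             x (Suc k) = (if f (yt k) < f (x k + lam k *\<^sub>R d k) then yt k
                          else x k + lam k *\<^sub>R d k))"

end

theory Submission
  imports Defs
begin

text \<open>The proximal point \<open>y\<close> of an iterate \<open>x\<close> satisfies a variational inequality. At \<open>x\<close>
  itself it bounds the predicted decrease by a multiple of \<open>|y - x|\<^sup>2\<close>, so that, by the descent
  lemma, the linesearch step is bounded away from 0 and each iteration decreases \<open>f\<close> by at least
  \<open>a |y - x|\<^sup>2\<close>; at the limit point it gives convergence of the function values. It also provides
  a subgradient of \<open>f\<close> at \<open>y\<close> (not at the next iterate) of norm at most \<open>b |y - x|\<close>. The KL
  inequality is therefore used at \<open>y\<close> and carried over to the next iterate, whose function value
  is not larger, since the derivative of the concave function \<open>\<phi>\<close> is nonincreasing. A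
  telescoping argument then bounds the length of the trajectory.\<close>

section \<open>Quadratic forms with bounded eigenvalues\<close>

text \<open>First-order optimality in one variable: for small \<open>t\<close> the quadratic term
  cannot offset a negative linear one. It turns minimality into an eigenvalue equation below and
  into a variational inequality for the proximal point later.\<close>

lemma linear_coeff_nonneg:
  fixes p q :: real
  assumes "\<And>t. 0 < t \<Longrightarrow> t \<le> 1 \<Longrightarrow> 0 \<le> t * p + t\<^sup>2 * q"
  shows "0 \<le> p"
proof (rule ccontr)
  assume "\<not> 0 \<le> p"
  \<comment> \<open>Chosen so that \<open>t * (\<bar>q\<bar> + 1)\<close> is at most
    \<open>- p / 2\<close>, which keeps \<open>p + t * q\<close> negative.\<close>
  define t where "t = min 1 (- p / (2 * (\<bar>q\<bar> + 1)))"
  have t: "0 < t" "t \<le> 1" "t \<le> - p / (2 * (\<bar>q\<bar> + 1))"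
    using \<open>\<not> 0 \<le> p\<close> by (auto simp: t_def intro!: divide_neg_pos)
  have "t * q \<le> t * (\<bar>q\<bar> + 1)" using t by (intro mult_left_mono) auto
  also have "\<dots> \<le> - p / 2" using t(3) by (simp add: field_simps)
  finally have "p + t * q < 0" using \<open>\<not> 0 \<le> p\<close> by simp
  moreover have "t * p + t\<^sup>2 * q = t * (p + t * q)" by (simp add: power2_eq_square algebra_simps)
  ultimately show False using assms[OF t(1,2)] t(1) by (simp add: mult_less_0_iff zero_le_mult_iff)
qed

lemma inner_matrix_self_adjoint:
  fixes D :: "real^'n^'n"
  assumes "transpose D = D"
  shows "u \<bullet> (D *v v) = (D *v u) \<bullet> v"
  using dot_lmul_matrix[of u D v] transpose_matrix_vector[of D u] assms by simp

text \<open>The quadratic form attains its minimum on the compact unit sphere, and a minimiser is an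
  eigenvector whose eigenvalue is that minimum. This turns bounds on eigenvalues into bounds on the
  form without diagonalising \<open>D\<close>.\<close>

lemma rayleigh_quotient_min:
  fixes D :: "real^'n^'n"
  assumes sym: "transpose D = D"
  obtains m where "real_eigenvalue D m" "\<And>x. m * (norm x)\<^sup>2 \<le> x \<bullet> (D *v x)"
proof -
  have "continuous_on (sphere 0 1) (\<lambda>x. x \<bullet> (D *v x))"
    by (intro continuous_intros linear_continuous_on matrix_vector_mul_bounded_linear)
  moreover have "sphere 0 1 \<noteq> ({} :: (real^'n) set)" by simp
  ultimately obtain v where v: "norm v = 1"
    and min: "\<And>x. norm x = 1 \<Longrightarrow> v \<bullet> (D *v v) \<le> x \<bullet> (D *v x)"
    using continuous_attains_inf[OF compact_sphere, of 0 1 "\<lambda>x. x \<bullet> (D *v x)"] by auto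
  define m where "m = v \<bullet> (D *v v)"
  have bound: "m * (norm x)\<^sup>2 \<le> x \<bullet> (D *v x)" for x
  proof (cases "x = 0")
    case False
    have "m \<le> (x /\<^sub>R norm x) \<bullet> (D *v (x /\<^sub>R norm x))"
      unfolding m_def using False by (intro min) simp
    also have "\<dots> = (x \<bullet> (D *v x)) / (norm x)\<^sup>2"
      by (simp add: matrix_vector_mult_scaleR power2_eq_square divide_simps)
    finally show ?thesis using False by (simp add: field_simps)
  qed simp
  define e where "e = D *v v - m *\<^sub>R v"
  \<comment> \<open>The form minus \<open>m * (norm x)\<^sup>2\<close> is nonnegative and vanishes
    at \<open>v\<close>. Along \<open>v - t *\<^sub>R e\<close> its linear coefficient is
    \<open>- (2 * (norm e)\<^sup>2)\<close>, so the residual \<open>e\<close> of the eigenvalue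
    equation is 0.\<close>
  have "0 \<le> - (2 * (norm e)\<^sup>2)"
  proof (rule linear_coeff_nonneg)
    fix t :: real
    let ?x = "v - t *\<^sub>R e"
    have "0 \<le> ?x \<bullet> (D *v ?x) - m * (norm ?x)\<^sup>2" using bound[of ?x] by simp
    also have "\<dots> = (m - m * (norm v)\<^sup>2) + t * (- (2 * ((D *v v) \<bullet> e - m * (v \<bullet> e))))
        + t\<^sup>2 * (e \<bullet> (D *v e) - m * (e \<bullet> e))"
      using inner_matrix_self_adjoint[OF sym, of v e]
      unfolding power2_norm_eq_inner
      by (simp add: m_def algebra_simps inner_commute power2_eq_square)
    also have "(D *v v) \<bullet> e - m * (v \<bullet> e) = (norm e)\<^sup>2"
      by (simp only: power2_norm_eq_inner inner_scaleR_left[symmetric] inner_diff_left[symmetric] e_def[symmetric])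
    finally show "0 \<le> t * - (2 * (norm e)\<^sup>2) + t\<^sup>2 * (e \<bullet> (D *v e) - m * (e \<bullet> e))"
      using v by simp
  qed
  then have "real_eigenvalue D m"
    unfolding real_eigenvalue_def using v by (intro exI[of _ v]) (auto simp: e_def)
  with bound show thesis by (rule that[rotated])
qed

lemma rayleigh_quotient_max:
  fixes D :: "real^'n^'n"
  assumes sym: "transpose D = D"
  obtains M where "real_eigenvalue D M" "\<And>x. x \<bullet> (D *v x) \<le> M * (norm x)\<^sup>2"
proof -
  have neg: "(- D) *v x = - (D *v x)" for x
    by (simp add: matrix_vector_mult_def vec_eq_iff sum_negf)
  have "transpose (- D) = - D"
    using sym by (simp add: transpose_def vec_eq_iff)
  then obtain m where m: "real_eigenvalue (- D) m"
    "\<And>x. m * (norm x)\<^sup>2 \<le> x \<bullet> (- D *v x)"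
    using rayleigh_quotient_min by blast
  show thesis
  proof (rule that[of "- m"])
    show "real_eigenvalue D (- m)"
      using m(1) unfolding real_eigenvalue_def neg
      by (metis (no_types) minus_minus scaleR_minus_left)
    show "x \<bullet> (D *v x) \<le> - m * (norm x)\<^sup>2" for x
      using m(2)[of x] by (simp add: neg)
  qed
qed

lemma spd_bounded_quadratic_form:
  fixes D :: "real^'n^'n"
  assumes "D \<in> spd_bounded \<mu>"
  shows "(norm x)\<^sup>2 / \<mu> \<le> x \<bullet> (D *v x)" "x \<bullet> (D *v x) \<le> \<mu> * (norm x)\<^sup>2"
proof -
  have sym: "transpose D = D"
    and eig: "\<And>c. real_eigenvalue D c \<Longrightarrow> 1 / \<mu> \<le> c \<and> c \<le> \<mu>"
    using assms by (auto simp: spd_bounded_def spd_matrix_def)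
  obtain m where m: "real_eigenvalue D m" "\<And>x. m * (norm x)\<^sup>2 \<le> x \<bullet> (D *v x)"
    using rayleigh_quotient_min[OF sym] by blast
  obtain M where M: "real_eigenvalue D M" "\<And>x. x \<bullet> (D *v x) \<le> M * (norm x)\<^sup>2"
    using rayleigh_quotient_max[OF sym] by blast
  have "1 / \<mu> * (norm x)\<^sup>2 \<le> m * (norm x)\<^sup>2"
    using eig[OF m(1)] by (intro mult_right_mono) auto
  with m(2)[of x] show "(norm x)\<^sup>2 / \<mu> \<le> x \<bullet> (D *v x)" by simp
  have "M * (norm x)\<^sup>2 \<le> \<mu> * (norm x)\<^sup>2"
    using eig[OF M(1)] by (intro mult_right_mono) auto
  with M(2)[of x] show "x \<bullet> (D *v x) \<le> \<mu> * (norm x)\<^sup>2" by simp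
qed

lemma norm_wrt_sq:
  assumes "D \<in> spd_bounded \<mu>"
  shows "(norm_wrt D x)\<^sup>2 = x \<bullet> (D *v x)"
proof -
  have "0 \<le> x \<bullet> (D *v x)"
    using assms by (cases "x = 0") (auto simp: spd_bounded_def spd_matrix_def less_imp_le)
  then show ?thesis by (simp add: norm_wrt_def)
qed

text \<open>Nonnegativity of the form at \<open>x - (1 / \<mu>) *\<^sub>R (D *v x)\<close>, with its
  upper bound at \<open>D *v x\<close>, gives
  \<open>(norm (D *v x))\<^sup>2 \<le> \<mu> * (x \<bullet> (D *v x))\<close>. Cauchy-Schwarz then
  allows one factor \<open>norm (D *v x)\<close> to be cancelled.\<close>

lemma spd_bounded_norm_le:
  fixes D :: "real^'n^'n"
  assumes D: "D \<in> spd_bounded \<mu>" and "1 \<le> \<mu>"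
  shows "norm (D *v x) \<le> \<mu> * norm x"
proof -
  let ?u = "D *v x" and ?z = "x - (1 / \<mu>) *\<^sub>R (D *v x)"
  have sym: "transpose D = D" using D by (simp add: spd_bounded_def spd_matrix_def)
  have "0 \<le> (norm ?z)\<^sup>2 / \<mu>" using \<open>1 \<le> \<mu>\<close> by simp
  also have "\<dots> \<le> ?z \<bullet> (D *v ?z)" by (rule spd_bounded_quadratic_form[OF D])
  also have "\<dots> = x \<bullet> ?u - 2 / \<mu> * (norm ?u)\<^sup>2 + 1 / \<mu>\<^sup>2 * (?u \<bullet> (D *v ?u))"
    using inner_matrix_self_adjoint[OF sym, of x ?u]
    unfolding power2_norm_eq_inner
    by (simp add: algebra_simps inner_commute power2_eq_square)
  also have "1 / \<mu>\<^sup>2 * (?u \<bullet> (D *v ?u)) \<le> 1 / \<mu>\<^sup>2 * (\<mu> * (norm ?u)\<^sup>2)"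
    by (intro mult_left_mono spd_bounded_quadratic_form[OF D]) simp
  also have "1 / \<mu>\<^sup>2 * (\<mu> * (norm ?u)\<^sup>2) = 1 / \<mu> * (norm ?u)\<^sup>2"
    using \<open>1 \<le> \<mu>\<close> by (simp add: power2_eq_square)
  finally have "1 / \<mu> * (norm ?u)\<^sup>2 \<le> x \<bullet> ?u" by (simp add: field_simps)
  also have "\<dots> \<le> norm x * norm ?u" by (rule norm_cauchy_schwarz)
  finally have "norm ?u * norm ?u \<le> \<mu> * norm x * norm ?u"
    using \<open>1 \<le> \<mu>\<close> by (simp add: field_simps power2_eq_square)
  then show ?thesis using \<open>1 \<le> \<mu>\<close> by (cases "norm ?u = 0") auto
qed

section \<open>Gradients and the descent lemma\<close>

lemma GDERIV_unique:
  assumes "GDERIV f x :> a" "GDERIV f x :> b"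
  shows "a = b"
proof -
  have "(\<lambda>h. h \<bullet> a) = (\<lambda>h. h \<bullet> b)"
    using assms unfolding gderiv_def by (rule has_derivative_unique)
  then have "(a - b) \<bullet> a = (a - b) \<bullet> b" by metis
  then have "(a - b) \<bullet> (a - b) = 0" by (simp add: inner_diff_right)
  then show ?thesis by simp
qed

lemma GDERIV_grad:
  assumes "cont_differentiable_on f S" "x \<in> S"
  shows "GDERIV f x :> grad f x"
proof -
  obtain g where "GDERIV f x :> g"
    using assms by (auto simp: cont_differentiable_on_def)
  then show ?thesis
    unfolding grad_def by (rule theI[of "\<lambda>g. GDERIV f x :> g"]) (blast intro: GDERIV_unique \<open>GDERIV f x :> g\<close>)
qed

lemma descent_lemma:
  assumes "convex S" and gderiv: "\<And>u. u \<in> S \<Longrightarrow> GDERIV f u :> grad f u"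
    and lip: "L-lipschitz_on S (grad f)" and "x \<in> S" "z \<in> S"
  shows "f z \<le> f x + grad f x \<bullet> (z - x) + L / 2 * (norm (z - x))\<^sup>2"
proof -
  define c where "c t = x + t *\<^sub>R (z - x)" for t
  \<comment> \<open>The claim reads \<open>g 1 \<le> g 0\<close>. The Lipschitz bound makes the
    derivative of \<open>g\<close> nonpositive, because the segment stays in the convex set
    \<open>S\<close>.\<close>
  define g where "g t = f (c t) - t * (grad f x \<bullet> (z - x)) - L / 2 * t\<^sup>2 * (norm (z - x))\<^sup>2" for t
  have "g 1 \<le> g 0"
  proof (rule DERIV_nonpos_imp_nonincreasing[of 0 1 g])
    fix t :: real assume t: "0 \<le> t" "t \<le> 1"
    have "c t = (1 - t) *\<^sub>R x + t *\<^sub>R z" by (simp add: c_def algebra_simps)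
    then have cS: "c t \<in> S"
      using convexD[OF \<open>convex S\<close> \<open>x \<in> S\<close> \<open>z \<in> S\<close>, of "1 - t" t] t by simp
    have "((\<lambda>t. f (c t)) has_derivative (\<lambda>h. (h *\<^sub>R (z - x)) \<bullet> grad f (c t))) (at t)"
    proof (rule has_derivative_compose[of c])
      show "(c has_derivative (\<lambda>h. h *\<^sub>R (z - x))) (at t)"
        unfolding c_def by (auto intro!: derivative_eq_intros)
      show "(f has_derivative (\<lambda>h. h \<bullet> grad f (c t))) (at (c t))"
        using gderiv[OF cS] by (simp add: gderiv_def)
    qed
    then have "((\<lambda>t. f (c t)) has_real_derivative grad f (c t) \<bullet> (z - x)) (at t)"
      by (simp add: has_field_derivative_def mult_commute_abs inner_commute)
    then have "(g has_real_derivative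
        grad f (c t) \<bullet> (z - x) - grad f x \<bullet> (z - x) - L * t * (norm (z - x))\<^sup>2) (at t)"
      unfolding g_def by (auto intro!: derivative_eq_intros)
    moreover have "(grad f (c t) - grad f x) \<bullet> (z - x) \<le> L * t * (norm (z - x))\<^sup>2"
    proof -
      have "(grad f (c t) - grad f x) \<bullet> (z - x) \<le> norm (grad f (c t) - grad f x) * norm (z - x)"
        by (rule norm_cauchy_schwarz)
      also have "\<dots> \<le> (L * norm (c t - x)) * norm (z - x)"
        using lipschitz_onD[OF lip cS \<open>x \<in> S\<close>]
        by (intro mult_right_mono) (auto simp: dist_norm)
      also have "\<dots> = L * t * (norm (z - x))\<^sup>2"
        using t by (simp add: c_def power2_eq_square)
      finally show ?thesis .
    qed
    ultimately show "\<exists>d. (g has_real_derivative d) (at t) \<and> d \<le> 0"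
      by (auto simp: inner_diff_left)
  qed simp
  then show ?thesis by (simp add: g_def c_def)
qed

section \<open>The proximal step and subgradients\<close>

lemma proper_fun_ereal_eq:
  assumes "proper_fun f" "x \<in> edom f"
  shows "f x = ereal (real_of_ereal (f x))"
  using assms by (cases "f x") (auto simp: proper_fun_def edom_def)

lemma econvex_convex_on:
  assumes "proper_fun f" "econvex_fun f"
  shows "convex_on (edom f) (\<lambda>x. real_of_ereal (f x))"
proof -
  let ?F = "\<lambda>x. real_of_ereal (f x)"
  have *: "f (u *\<^sub>R x + v *\<^sub>R y) \<le> ereal (u * ?F x + v * ?F y)"
    if "x \<in> edom f" "y \<in> edom f" "0 \<le> u" "0 \<le> v" "u + v = 1" for x y u v
  proof -
    have "f (u *\<^sub>R x + v *\<^sub>R y) \<le> ereal u * f x + ereal v * f y"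
      using assms(2) that by (auto simp: econvex_fun_def)
    also have "\<dots> = ereal u * ereal (?F x) + ereal v * ereal (?F y)"
      using proper_fun_ereal_eq[OF assms(1)] that by metis
    finally show ?thesis by simp
  qed
  have dom: "convex (edom f)"
    by (rule convexI) (use * in \<open>fastforce simp: edom_def intro: le_less_trans\<close>)
  show ?thesis
    unfolding convex_on_def
  proof (intro conjI ballI allI impI dom)
    fix x y u v assume a: "x \<in> edom f" "y \<in> edom f" "0 \<le> u" "0 \<le> v" "u + v = (1::real)"
    then have "u *\<^sub>R x + v *\<^sub>R y \<in> edom f" using dom by (simp add: convex_def)
    then show "?F (u *\<^sub>R x + v *\<^sub>R y) \<le> u * ?F x + v * ?F y"
      using *[OF a] proper_fun_ereal_eq[OF assms(1)] by (metis ereal_less_eq(3))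
  qed
qed

lemma h_model_eq:
  assumes "proper_fun f1" "D \<in> spd_bounded \<mu>" "xk \<in> edom f1" "z \<in> edom f1"
  shows "h_model f0 f1 \<alpha> D xk \<gamma> z =
    ereal (grad f0 xk \<bullet> (z - xk) + \<gamma> / (2 * \<alpha>) * ((z - xk) \<bullet> (D *v (z - xk)))
      + real_of_ereal (f1 z) - real_of_ereal (f1 xk))"
proof -
  obtain a b where "f1 xk = ereal a" "f1 z = ereal b"
    using proper_fun_ereal_eq[OF assms(1,3)] proper_fun_ereal_eq[OF assms(1,4)] by blast
  then show ?thesis by (simp add: h_model_def norm_wrt_sq[OF assms(2)])
qed

lemma h_model_outside:
  assumes "proper_fun f1" "xk \<in> edom f1" "z \<notin> edom f1"
  shows "h_model f0 f1 \<alpha> D xk \<gamma> z = \<infinity>"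
  using proper_fun_ereal_eq[OF assms(1,2)] assms(3)
  by (cases "f1 xk") (auto simp: h_model_def edom_def)

text \<open>Fermat's rule: the left factor of the inner product is a convex subgradient of
  \<open>f1\<close> at \<open>y\<close>. On the segment from \<open>y\<close> to \<open>z\<close>
  the change of \<open>f1\<close> is at most linear in \<open>t\<close>, and the rest of the model
  adds a linear and a quadratic term, so \<open>linear_coeff_nonneg\<close> applies.\<close>

lemma arg_min_h_model_variational:
  assumes "proper_fun f1" "econvex_fun f1" and D: "D \<in> spd_bounded \<mu>" and "0 < \<alpha>"
    and xk: "xk \<in> edom f1" and min: "is_arg_min (h_model f0 f1 \<alpha> D xk 1) (\<lambda>_. True) y"
  shows "y \<in> edom f1"
    and "\<And>z. z \<in> edom f1 \<Longrightarrow>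
      real_of_ereal (f1 y) + (- grad f0 xk - (1 / \<alpha>) *\<^sub>R (D *v (y - xk))) \<bullet> (z - y)
        \<le> real_of_ereal (f1 z)"
proof -
  let ?F = "\<lambda>z. real_of_ereal (f1 z)" and ?h = "h_model f0 f1 \<alpha> D xk 1"
  have le: "?h y \<le> ?h z" for z using min by (auto simp: is_arg_min_def not_less)
  show y: "y \<in> edom f1"
  proof (rule ccontr)
    assume "y \<notin> edom f1"
    then have "?h y = \<infinity>" by (rule h_model_outside[OF assms(1) xk])
    then show False using le[of xk] h_model_eq[OF assms(1) D xk xk, of f0 \<alpha> 1] by simp
  qed
  fix z assume z: "z \<in> edom f1"
  have sym: "transpose D = D" using D by (simp add: spd_bounded_def spd_matrix_def)
  let ?d = "y - xk" and ?e = "z - y"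
  have "0 \<le> grad f0 xk \<bullet> ?e + 1 / \<alpha> * (?e \<bullet> (D *v ?d)) + ?F z - ?F y"
  proof (rule linear_coeff_nonneg)
    fix t :: real assume t: "0 < t" "t \<le> 1"
    have conv: "convex_on (edom f1) ?F" by (rule econvex_convex_on[OF assms(1,2)])
    let ?p = "(1 - t) *\<^sub>R y + t *\<^sub>R z"
    have p: "?p \<in> edom f1"
      using convex_on_imp_convex[OF conv] y z t by (simp add: convex_def)
    have Fp: "?F ?p \<le> (1 - t) * ?F y + t * ?F z"
      using convex_onD[OF conv] t y z by simp
    have peq: "?p - xk = ?d + t *\<^sub>R ?e" by (simp add: algebra_simps)
    have "grad f0 xk \<bullet> ?d + 1 / (2 * \<alpha>) * (?d \<bullet> (D *v ?d)) + ?F y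
        \<le> grad f0 xk \<bullet> (?p - xk) + 1 / (2 * \<alpha>) * ((?p - xk) \<bullet> (D *v (?p - xk))) + ?F ?p"
      using le[of ?p] unfolding h_model_eq[OF assms(1) D xk y] h_model_eq[OF assms(1) D xk p]
      by simp
    moreover have "(?p - xk) \<bullet> (D *v (?p - xk))
        = ?d \<bullet> (D *v ?d) + 2 * t * (?e \<bullet> (D *v ?d)) + t\<^sup>2 * (?e \<bullet> (D *v ?e))"
    proof -
      have "?d \<bullet> (D *v ?e) = ?e \<bullet> (D *v ?d)"
        using inner_matrix_self_adjoint[OF sym, of ?d ?e] by (simp add: inner_commute)
      then show ?thesis
        unfolding peq
        by (simp only: matrix_vector_right_distrib matrix_vector_mult_scaleR inner_add_left
            inner_add_right inner_scaleR_left inner_scaleR_right power2_eq_square)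
          (simp add: algebra_simps)
    qed
    moreover have "grad f0 xk \<bullet> (?p - xk) = grad f0 xk \<bullet> ?d + t * (grad f0 xk \<bullet> ?e)"
      unfolding peq by (simp only: inner_add_right inner_scaleR_right)
    moreover have "1 / (2 * \<alpha>) * (A + 2 * t * B + t\<^sup>2 * C)
        = 1 / (2 * \<alpha>) * A + t * (1 / \<alpha> * B) + t\<^sup>2 * (1 / (2 * \<alpha>) * C)" for A B C
      using \<open>0 < \<alpha>\<close> by (simp add: field_simps)
    ultimately show "0 \<le> t * (grad f0 xk \<bullet> ?e + 1 / \<alpha> * (?e \<bullet> (D *v ?d)) + ?F z - ?F y)
        + t\<^sup>2 * (1 / (2 * \<alpha>) * (?e \<bullet> (D *v ?e)))"
      using Fp by (simp add: ring_distribs)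
  qed
  then show "?F y + (- grad f0 xk - (1 / \<alpha>) *\<^sub>R (D *v ?d)) \<bullet> ?e \<le> ?F z"
    by (simp add: inner_diff_left inner_commute[of "D *v ?d"])
qed

lemma edom_objective: "edom (objective f0 f1) = edom f1"
proof -
  have "objective f0 f1 z < \<infinity> \<longleftrightarrow> f1 z < \<infinity>" for z
    by (cases "f1 z") (auto simp: objective_def)
  then show ?thesis by (simp add: edom_def)
qed

lemma objective_eq:
  assumes "proper_fun f1" "z \<in> edom f1"
  shows "objective f0 f1 z = ereal (f0 z + real_of_ereal (f1 z))"
  using proper_fun_ereal_eq[OF assms] by (metis objective_def plus_ereal.simps(1))

text \<open>The affine minorant of \<open>f1\<close> holds globally, so the only error in the
  difference quotient is the first-order remainder of \<open>f0\<close>, which is small near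
  \<open>y\<close>. Outside the domain the quotient is \<infinity>.\<close>

lemma frechet_subdiff_objective:
  assumes proper: "proper_fun f1" and y: "y \<in> edom f1" and g: "GDERIV f0 y :> g"
    and w: "\<And>z. z \<in> edom f1 \<Longrightarrow> real_of_ereal (f1 y) + w \<bullet> (z - y) \<le> real_of_ereal (f1 z)"
  shows "g + w \<in> frechet_subdiff (objective f0 f1) y"
proof -
  let ?f = "objective f0 f1" and ?F = "\<lambda>z. real_of_ereal (f1 z)"
  let ?q = "\<lambda>z. ereal (1 / norm (y - z)) * (?f z - ?f y - ereal ((z - y) \<bullet> (g + w)))"
  have "\<forall>\<^sub>F z in at y. c < ?q z" if "c < 0" for c
  proof -
    \<comment> \<open>A real tolerance strictly between \<open>c\<close> and 0 is interposed, since
      \<open>c\<close> may be \<open>-\<infinity>\<close> and the inequality to be shown is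
      strict.\<close>
    obtain e0 :: real where e0: "c < ereal e0" "ereal e0 < 0"
      using ereal_dense2[OF \<open>c < 0\<close>] by blast
    define e where "e = - e0"
    have e: "c < ereal (- e)" "0 < e" using e0 by (simp_all add: e_def)
    obtain \<delta> where \<delta>: "0 < \<delta>" "\<And>z. norm (z - y) < \<delta> \<Longrightarrow>
        \<bar>f0 z - f0 y - (z - y) \<bullet> g\<bar> \<le> e * norm (z - y)"
      using g \<open>0 < e\<close> unfolding gderiv_def has_derivative_at_alt real_norm_def by metis
    have "c < ?q z" if z: "z \<noteq> y" "dist z y < \<delta>" for z
    proof (cases "z \<in> edom f1")
      case True
      have "- (e * norm (z - y)) \<le> f0 z + ?F z - (f0 y + ?F y) - (z - y) \<bullet> (g + w)"
        using \<delta>(2)[of z] z w[OF True] by (simp add: dist_norm inner_add_right inner_commute)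
      then have "- e \<le> 1 / norm (y - z) * (f0 z + ?F z - (f0 y + ?F y) - (z - y) \<bullet> (g + w))"
        using z by (simp add: field_simps norm_minus_commute)
      then show ?thesis
        unfolding objective_eq[OF proper True] objective_eq[OF proper y]
        using less_le_trans[OF e(1)] by (simp only: ereal_minus(1) times_ereal.simps ereal_less_eq(3))
    next
      case False
      then have "?f z = \<infinity>" by (auto simp: edom_def objective_def)
      then have "?q z = \<infinity>" unfolding objective_eq[OF proper y] using z by simp
      then show ?thesis using \<open>c < 0\<close> by (simp add: less_top[symmetric] top_ereal_def) auto
    qed
    then show ?thesis unfolding eventually_at by (intro exI[of _ \<delta>] conjI \<delta>(1)) blast
  qed
  then have "0 \<le> Liminf (at y) ?q" unfolding le_Liminf_iff by blast
  then show ?thesis using y by (simp add: frechet_subdiff_def edom_objective)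
qed

lemma lsc_fun_le_lim:
  assumes "lsc_fun f" "u \<longlonglongrightarrow> x" "(\<lambda>n. f (u n)) \<longlonglongrightarrow> l"
  shows "f x \<le> l"
proof (rule ccontr)
  assume "\<not> f x \<le> l"
  then obtain c where c: "l < c" "c < f x" using dense by (metis not_le)
  have "\<forall>\<^sub>F z in at x. c < f z"
    using assms(1) c(2) by (auto simp: lsc_fun_def le_Liminf_iff)
  \<comment> \<open>\<open>lsc_fun\<close> only speaks of punctured neighbourhoods, whereas the
    sequence may hit \<open>x\<close>; there the bound is \<open>c < f x\<close>.\<close>
  then have "\<forall>\<^sub>F z in nhds x. c < f z"
    using c(2) by (simp add: eventually_nhds_conv_at)
  then have "\<forall>\<^sub>F n in sequentially. c < f (u n)"
    using assms(2) by (auto simp: filterlim_iff)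
  then have "c \<le> l"
    by (intro tendsto_lowerbound[OF assms(3)]) (auto elim: eventually_mono)
  then show False using c(1) by simp
qed

lemma frechet_subdiff_subset_limiting: "frechet_subdiff \<Psi> x \<subseteq> limiting_subdiff \<Psi> x"
proof
  fix v assume v: "v \<in> frechet_subdiff \<Psi> x"
  then have "x \<in> edom \<Psi>" by (simp add: frechet_subdiff_def)
  then show "v \<in> limiting_subdiff \<Psi> x"
    unfolding limiting_subdiff_def
    by (intro CollectI conjI exI[of _ "\<lambda>_. x"] exI[of _ "\<lambda>_. v"]) (simp_all add: v)
qed

section \<open>Finite length from the KL inequality\<close>

lemma concave_on_le_tangent:
  fixes \<phi> :: "real \<Rightarrow> real"
  assumes "concave_on A \<phi>" "(\<phi> has_real_derivative l) (at c)" "c \<in> interior A" "s \<in> A"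
  shows "\<phi> s - \<phi> c \<le> l * (s - c)"
proof -
  have "convex_on A (\<lambda>s. - \<phi> s)" using assms(1) by (simp add: concave_on_def)
  moreover have "connected A"
    using convex_on_imp_convex[OF calculation] by (rule convex_connected)
  moreover have "((\<lambda>s. - \<phi> s) has_real_derivative - l) (at c within A)"
    by (rule has_field_derivative_at_within[OF DERIV_minus[OF assms(2)]])
  ultimately have "- l * (s - c) \<le> - \<phi> s - - \<phi> c"
    using assms(3,4) by (intro convex_on_imp_above_tangent) auto
  then show ?thesis by simp
qed

text \<open>With \<open>C = b / a\<close>, concavity of \<open>\<phi>\<close> and the KL inequality at the trial point give
  \<open>2 |d (k+1)| \<le> |d k| + C (\<phi> (r (k+1)) - \<phi> (r (k+2)))\<close>, a telescoping bound that
  also keeps all later trial points inside the neighbourhood where the KL inequality holds.\<close>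

lemma kl_descent_summable:
  fixes x d :: "nat \<Rightarrow> 'a::real_normed_vector" and r s :: "nat \<Rightarrow> real"
    and \<phi> \<phi>' :: "real \<Rightarrow> real" and \<upsilon> :: ereal
  assumes r_nonneg: "\<And>k. 0 \<le> r k" and r_lim: "r \<longlonglongrightarrow> 0"
    and a: "0 < a" and decrease: "\<And>k. a * (norm (d k))\<^sup>2 \<le> r k - r (Suc k)"
    and step: "\<And>k. norm (x (Suc k) - x k) \<le> norm (d k)" and d_lim: "d \<longlonglongrightarrow> 0"
    and rs: "\<And>k. r (Suc k) \<le> s k" and s_lim: "s \<longlonglongrightarrow> 0"
    and sub: "strict_mono q" "(x \<circ> q) \<longlonglongrightarrow> xbar"
    and \<upsilon>: "0 < \<upsilon>" and \<phi>_cont: "continuous_on {t. 0 \<le> t \<and> ereal t < \<upsilon>} \<phi>"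
    and \<phi>_concave: "concave_on {t. 0 \<le> t \<and> ereal t < \<upsilon>} \<phi>"
    and \<phi>_nonneg: "\<And>t. 0 \<le> t \<Longrightarrow> ereal t < \<upsilon> \<Longrightarrow> 0 \<le> \<phi> t" and \<phi>_zero: "\<phi> 0 = 0"
    and \<phi>_deriv: "\<And>t. 0 < t \<Longrightarrow> ereal t < \<upsilon> \<Longrightarrow> (\<phi> has_real_derivative \<phi>' t) (at t)"
    and \<rho>: "0 < \<rho>" and b: "0 < b"
    and kl: "\<And>k. norm (x k + d k - xbar) < \<rho> \<Longrightarrow> 0 < s k \<Longrightarrow> ereal (s k) < \<upsilon> \<Longrightarrow>
      1 \<le> \<phi>' (s k) * (b * norm (d k))"
  shows "summable (\<lambda>k. norm (d k))"
proof -
  have r_mono: "r (Suc k) \<le> r k" for k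
  proof -
    have "0 \<le> a * (norm (d k))\<^sup>2" using a by simp
    with decrease[of k] show ?thesis by linarith
  qed
  show ?thesis
  proof (cases "\<exists>k. r k = 0")
    \<comment> \<open>Once the gap \<open>r\<close> is 0 it stays 0, and the decrease inequality
      forces all later \<open>d\<close> to vanish. Otherwise all gaps are positive, as the KL
      inequality requires.\<close>
    case True
    then obtain k where k: "r k = 0" by blast
    have "decseq r" using r_mono by (rule decseq_SucI)
    then have "r j = 0" if "k \<le> j" for j
      using decseqD[of r k j] that k r_nonneg[of j] by auto
    then have "d j = 0" if "k \<le> j" for j
      using decrease[of j] a that by (simp add: mult_le_0_iff)
    then show ?thesis
      by (intro summable_finite[of "{..<k}"]) (auto simp: not_less)
  next
    case False
    let ?A = "{t. 0 \<le> t \<and> ereal t < \<upsilon>}"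
    define C where "C = b / a"
    have C: "0 < C" using a b by (simp add: C_def)
    have r_pos: "0 < r k" for k using False r_nonneg[of k] by (metis less_eq_real_def)
    have s_pos: "0 < s k" for k using r_pos[of "Suc k"] rs[of k] by linarith
    have "open {t. ereal t < \<upsilon>}" by (intro open_Collect_less continuous_intros)
    then have "open ({0<..} \<inter> {t. ereal t < \<upsilon>})" by (intro open_Int) auto
    then have int: "t \<in> interior ?A" if "0 < t" "ereal t < \<upsilon>" for t
      using that by (intro interiorI[of "{0<..} \<inter> {t. ereal t < \<upsilon>}"]) auto
    have tangent: "\<phi> t' - \<phi> t \<le> \<phi>' t * (t' - t)" if "0 < t" "ereal t < \<upsilon>" "0 \<le> t'" "ereal t' < \<upsilon>" for t t'
      using concave_on_le_tangent[OF \<phi>_concave \<phi>_deriv[OF that(1,2)] int[OF that(1,2)]] that by simp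
    \<comment> \<open>The sum of the tangent inequalities at \<open>t\<close> and at
      \<open>t'\<close> is the monotonicity of the derivative.\<close>
    have antimono: "\<phi>' t \<le> \<phi>' t'" if "0 < t'" "t' \<le> t" "ereal t < \<upsilon>" for t t'
    proof (cases "t' = t")
      case False
      have "ereal t' < \<upsilon>" using that(2,3) by (meson ereal_less_eq(3) le_less_trans)
      then have "0 \<le> (\<phi>' t' - \<phi>' t) * (t - t')"
        using tangent[of t t'] tangent[of t' t] that by (simp add: algebra_simps)
      then show ?thesis using that False by (simp add: zero_le_mult_iff)
    qed simp
    have recurrence: "2 * norm (d (Suc k)) + C * \<phi> (r (Suc (Suc k))) \<le> norm (d k) + C * \<phi> (r (Suc k))"
      if near: "norm (x k + d k - xbar) < \<rho>" and small: "ereal (s k) < \<upsilon>" "ereal (r (Suc (Suc k))) < \<upsilon>" for k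
    proof -
      let ?p = "norm (d k)" and ?n = "norm (d (Suc k))" and ?r = "r (Suc k)" and ?r' = "r (Suc (Suc k))"
      have r_small: "ereal ?r < \<upsilon>" using rs small(1) by (meson ereal_less_eq(3) le_less_trans)
      have "1 \<le> \<phi>' (s k) * (b * ?p)" by (rule kl[OF near s_pos small(1)])
      \<comment> \<open>The KL inequality is known at the gap \<open>s k\<close> of the trial point,
        but telescoping needs it at the smaller gap of the next iterate.\<close>
      also have "\<dots> \<le> \<phi>' ?r * (b * ?p)"
        using antimono[OF r_pos rs small(1)] b by (intro mult_right_mono) auto
      finally have one: "1 \<le> \<phi>' ?r * (b * ?p)" .
      then have "?p \<noteq> 0" by auto
      then have p: "0 < ?p" by simp
      \<comment> \<open>The decrease of iteration \<open>k + 1\<close> is multiplied by the KL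
        inequality of iteration \<open>k\<close>; the tangent inequality turns the product of
        derivative and gap difference into a difference of values of \<open>\<phi>\<close>.\<close>
      have "a * ?n\<^sup>2 \<le> (?r - ?r') * 1" using decrease[of "Suc k"] by simp
      also have "\<dots> \<le> (?r - ?r') * (\<phi>' ?r * (b * ?p))"
        by (intro mult_left_mono one) (use r_mono[of "Suc k"] in simp)
      also have "\<dots> = (\<phi>' ?r * (?r - ?r')) * (b * ?p)" by simp
      also have "\<dots> \<le> (\<phi> ?r - \<phi> ?r') * (b * ?p)"
        using tangent[OF r_pos r_small r_nonneg small(2)] b by (intro mult_right_mono) (auto simp: algebra_simps)
      finally have "?n\<^sup>2 \<le> C * (\<phi> ?r - \<phi> ?r') * ?p"
        using a by (simp add: C_def field_simps)
      \<comment> \<open>The arithmetic-geometric mean inequality replaces the bound on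
        \<open>?n\<^sup>2\<close> by one linear in \<open>?n\<close>, after cancelling
        \<open>?p\<close>.\<close>
      moreover have "0 \<le> (?p - ?n)\<^sup>2" by simp
      ultimately have "2 * ?n * ?p \<le> (?p + C * (\<phi> ?r - \<phi> ?r')) * ?p"
        by (simp add: power2_eq_square algebra_simps)
      then have "2 * ?n \<le> ?p + C * (\<phi> ?r - \<phi> ?r')" using p by simp
      then show ?thesis by (simp add: algebra_simps)
    qed
    have ev_small: "\<forall>\<^sub>F k in sequentially. ereal (u k) < \<upsilon>" if "u \<longlonglongrightarrow> 0" for u :: "nat \<Rightarrow> real"
      using that \<upsilon> by (intro order_tendstoD(2)[of "\<lambda>k. ereal (u k)" 0]) (simp_all add: zero_ereal_def)
    \<comment> \<open>Distance to \<open>xbar\<close> plus the whole length allowance from there on.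
      It vanishes along the subsequence, so some start index leaves enough room inside the ball of
      radius \<open>\<rho>\<close>.\<close>
    have "((\<lambda>k. norm (x (q k) - xbar) + 2 * norm (d (q k)) + C * \<phi> (r (Suc (q k)))) \<longlongrightarrow> 0 + 2 * 0 + C * \<phi> 0) sequentially"
    proof (intro tendsto_intros)
      show "(\<lambda>k. norm (x (q k) - xbar)) \<longlonglongrightarrow> 0"
        using sub(2) by (simp add: o_def LIM_zero tendsto_norm_zero)
      show "(\<lambda>k. norm (d (q k))) \<longlonglongrightarrow> 0"
        using LIMSEQ_subseq_LIMSEQ[OF d_lim sub(1)] by (simp add: o_def tendsto_norm_zero)
      have r': "(\<lambda>k. r (Suc k)) \<longlonglongrightarrow> 0" using r_lim by (rule LIMSEQ_Suc)
      have "(\<lambda>k. \<phi> (r (Suc k))) \<longlonglongrightarrow> \<phi> 0"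
      proof (rule continuous_on_tendsto_compose[OF \<phi>_cont r'])
        show "0 \<in> ?A" using \<upsilon> by (simp add: zero_ereal_def)
        show "\<forall>\<^sub>F k in sequentially. r (Suc k) \<in> ?A"
          using ev_small[OF r'] by (rule eventually_mono) (simp add: r_nonneg)
      qed
      from LIMSEQ_subseq_LIMSEQ[OF this sub(1)]
      show "(\<lambda>k. \<phi> (r (Suc (q k)))) \<longlonglongrightarrow> \<phi> 0" by (simp add: o_def)
    qed
    then have ev1: "\<forall>\<^sub>F k in sequentially. norm (x (q k) - xbar) + 2 * norm (d (q k)) + C * \<phi> (r (Suc (q k))) < \<rho>"
      using \<rho> \<phi>_zero by (intro order_tendstoD(2)) auto
    obtain K where K: "\<And>k. k \<ge> K \<Longrightarrow> ereal (s k) < \<upsilon>" "\<And>k. k \<ge> K \<Longrightarrow> ereal (r k) < \<upsilon>"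
      using eventually_conj[OF ev_small[OF s_lim] ev_small[OF r_lim]]
      unfolding eventually_sequentially by blast
    obtain J where J: "\<And>j. J \<le> j \<Longrightarrow> norm (x (q j) - xbar) + 2 * norm (d (q j)) + C * \<phi> (r (Suc (q j))) < \<rho>"
      using ev1 unfolding eventually_sequentially by blast
    define j where "j = max J K"
    have j: "K \<le> j" "norm (x (q j) - xbar) + 2 * norm (d (q j)) + C * \<phi> (r (Suc (q j))) < \<rho>"
      using J[of j] by (simp_all add: j_def)
    define N where "N = q j"
    have N: "K \<le> N" using j(1) seq_suble[OF sub(1), of j] by (simp add: N_def)
    \<comment> \<open>The factor 2 is needed at \<open>n = 0\<close> of \<open>budget\<close>: one
      \<open>norm (d N)\<close> is the first summand, the other is the term carried along.\<close>
    let ?E = "2 * norm (d N) + C * \<phi> (r (Suc N))"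
    have E: "norm (x N - xbar) + ?E < \<rho>" using j(2) by (simp add: N_def)
    \<comment> \<open>The sum includes \<open>i = n\<close> because the trial point lies one further
      displacement beyond \<open>x (N + n)\<close>.\<close>
    have travel: "norm (x (N + n) + d (N + n) - x N) \<le> (\<Sum>i\<le>n. norm (d (N + i)))" for n
    proof -
      have "norm (x (N + n) - x N) \<le> (\<Sum>i<n. norm (d (N + i)))"
      proof (induction n)
        case (Suc n)
        have "norm (x (N + Suc n) - x N) \<le> norm (x (Suc (N + n)) - x (N + n)) + norm (x (N + n) - x N)"
          using norm_triangle_ineq[of "x (Suc (N + n)) - x (N + n)" "x (N + n) - x N"] by simp
        then show ?case using Suc step[of "N + n"] by simp
      qed simp
      moreover have "norm (x (N + n) + d (N + n) - x N) \<le> norm (x (N + n) - x N) + norm (d (N + n))"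
        using norm_triangle_ineq[of "x (N + n) - x N" "d (N + n)"] by (simp add: add_diff_eq diff_add_eq)
      moreover have "(\<Sum>i\<le>n. norm (d (N + i))) = (\<Sum>i<n. norm (d (N + i))) + norm (d (N + n))"
        by (simp only: sum.lessThan_Suc flip: lessThan_Suc_atMost)
      ultimately show ?thesis by linarith
    qed
    have \<phi>_tail: "0 \<le> C * \<phi> (r (Suc (N + n)))" for n
      using C \<phi>_nonneg[OF r_nonneg K(2)] N by simp
    \<comment> \<open>The bound at \<open>n\<close> keeps the trial point in the ball, which makes
      \<open>recurrence\<close> available; that in turn says that the left side does not grow from
      \<open>n\<close> to \<open>n + 1\<close>.\<close>
    have budget: "(\<Sum>i\<le>n. norm (d (N + i))) + norm (d (N + n)) + C * \<phi> (r (Suc (N + n))) \<le> ?E" for n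
    proof (induction n)
      case (Suc n)
      then have "(\<Sum>i\<le>n. norm (d (N + i))) \<le> ?E"
        using \<phi>_tail[of n] norm_ge_zero[of "d (N + n)"] by linarith
      then have "norm (x (N + n) + d (N + n) - xbar) < \<rho>"
        using travel[of n] E norm_triangle_ineq[of "x (N + n) + d (N + n) - x N" "x N - xbar"] by simp
      from recurrence[OF this] K N Suc show ?case by simp
    qed simp
    have length: "(\<Sum>i\<le>n. norm (d (N + i))) \<le> ?E" for n
      using budget[of n] \<phi>_tail[of n] norm_ge_zero[of "d (N + n)"] by linarith
    have "summable (\<lambda>i. norm (d (N + i)))"
    proof (rule summableI_nonneg_bounded)
      fix n
      have "(\<Sum>i<n. norm (d (N + i))) \<le> (\<Sum>i\<le>n. norm (d (N + i)))"
        by (intro sum_mono2) auto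
      also have "\<dots> \<le> ?E"
        by (rule length)
      finally show "(\<Sum>i<n. norm (d (N + i))) \<le> ?E" .
    qed simp
    then show ?thesis using summable_iff_shift[of "\<lambda>k. norm (d k)" N] by (simp add: add.commute)
  qed
qed

section \<open>One iteration of the algorithm\<close>

text \<open>Smoothness on an open set enters through its consequence that \<open>f0\<close> has a
  full derivative at every point of the domain of \<open>f1\<close>, boundary points
  included.\<close>

locale smooth_plus_convex =
  fixes f0 :: "real^'n \<Rightarrow> real" and f1 :: "real^'n \<Rightarrow> ereal" and L :: real
  assumes proper: "proper_fun f1" and convex: "econvex_fun f1"
    and gderiv: "\<And>u. u \<in> edom f1 \<Longrightarrow> GDERIV f0 u :> grad f0 u"
    and L_pos: "0 < L" and lip: "L-lipschitz_on (edom f1) (grad f0)"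
begin

text \<open>Allows real arithmetic. Outside the domain \<open>real_of_ereal\<close> sends
  \<infinity> to 0, so \<open>F\<close> represents the objective only on
  \<open>edom f1\<close>.\<close>

definition F :: "real^'n \<Rightarrow> real" where
  "F z = f0 z + real_of_ereal (f1 z)"

lemma objective_eq_F: "z \<in> edom f1 \<Longrightarrow> objective f0 f1 z = ereal (F z)"
  unfolding F_def by (rule objective_eq[OF proper])

text \<open>Convexity handles \<open>f1\<close> and the descent lemma handles
  \<open>f0\<close>.\<close>

lemma segment_upper_bound:
  assumes x: "x \<in> edom f1" and y: "y \<in> edom f1" and t: "0 \<le> t" "t \<le> 1"
  shows "x + t *\<^sub>R (y - x) \<in> edom f1"
    and "F (x + t *\<^sub>R (y - x)) \<le> F x
      + t * (grad f0 x \<bullet> (y - x) + real_of_ereal (f1 y) - real_of_ereal (f1 x))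
      + L / 2 * t\<^sup>2 * (norm (y - x))\<^sup>2"
proof -
  let ?F = "\<lambda>x. real_of_ereal (f1 x)"
  have conv: "convex_on (edom f1) ?F" by (rule econvex_convex_on[OF proper convex])
  have dom: "convex (edom f1)" by (rule convex_on_imp_convex[OF conv])
  have eq: "x + t *\<^sub>R (y - x) = (1 - t) *\<^sub>R x + t *\<^sub>R y" by (simp add: algebra_simps)
  show p: "x + t *\<^sub>R (y - x) \<in> edom f1"
    unfolding eq using dom x y t by (simp add: convex_def)
  have "?F (x + t *\<^sub>R (y - x)) \<le> (1 - t) * ?F x + t * ?F y"
    unfolding eq using convex_onD[OF conv] t x y by simp
  moreover have "f0 (x + t *\<^sub>R (y - x)) \<le> f0 x + t * (grad f0 x \<bullet> (y - x)) + L / 2 * t\<^sup>2 * (norm (y - x))\<^sup>2"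
    using descent_lemma[OF dom gderiv lip x p] by (simp add: power_mult_distrib)
  ultimately show "F (x + t *\<^sub>R (y - x)) \<le> F x
      + t * (grad f0 x \<bullet> (y - x) + ?F y - ?F x) + L / 2 * t\<^sup>2 * (norm (y - x))\<^sup>2"
    by (simp add: F_def ring_distribs)
qed

lemma armijo_iff:
  assumes "x \<in> edom f1" "x + \<delta> ^ j *\<^sub>R d \<in> edom f1"
  shows "armijo (objective f0 f1) \<delta> \<beta> x d (ereal H) j \<longleftrightarrow>
    F (x + \<delta> ^ j *\<^sub>R d) \<le> F x + \<beta> * \<delta> ^ j * H"
  using assms by (simp add: armijo_def objective_eq_F)

text \<open>If \<open>i > 0\<close>, the step \<open>\<delta> ^ (i - 1)\<close> was rejected.
  Failure of the test against \<open>segment_upper_bound\<close> forces that step above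
  \<open>2 * (1 - \<beta>) * \<kappa> / L\<close>, and the accepted one is only a factor
  \<open>\<delta>\<close> smaller.\<close>

lemma armijo_step_lower_bound:
  assumes x: "x \<in> edom f1" and y: "y \<in> edom f1"
    and H: "grad f0 x \<bullet> (y - x) + real_of_ereal (f1 y) - real_of_ereal (f1 x) \<le> H"
      "H \<le> - (\<kappa> * (norm (y - x))\<^sup>2)"
    and \<delta>: "0 < \<delta>" "\<delta> < 1" and \<beta>: "0 < \<beta>" "\<beta> < 1"
    and min: "\<And>j. j < i \<Longrightarrow> \<not> armijo (objective f0 f1) \<delta> \<beta> x (y - x) (ereal H) j"
  shows "min 1 (2 * \<delta> * (1 - \<beta>) * \<kappa> / L) \<le> \<delta> ^ i"
proof (cases i)
  case (Suc j)
  define t where "t = \<delta> ^ j"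
  have t: "0 < t" "t \<le> 1" using \<delta> by (auto simp: t_def power_le_one)
  have p: "x + t *\<^sub>R (y - x) \<in> edom f1" using segment_upper_bound(1)[OF x y] t by simp
  have "F x + \<beta> * t * H < F (x + t *\<^sub>R (y - x))"
    using min[of j] Suc armijo_iff[OF x p[unfolded t_def]] by (simp add: t_def)
  also have "\<dots> \<le> F x + t * (grad f0 x \<bullet> (y - x) + real_of_ereal (f1 y) - real_of_ereal (f1 x))
      + L / 2 * t\<^sup>2 * (norm (y - x))\<^sup>2"
    using segment_upper_bound(2)[OF x y] t by simp
  also have "\<dots> \<le> F x + t * H + L / 2 * t\<^sup>2 * (norm (y - x))\<^sup>2"
    using mult_left_mono[OF H(1), of t] t by simp
  finally have "0 < t * (L / 2 * t * (norm (y - x))\<^sup>2 + (1 - \<beta>) * H)"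
    by (simp add: algebra_simps power2_eq_square)
  then have "0 < L / 2 * t * (norm (y - x))\<^sup>2 + (1 - \<beta>) * H"
    using t by (simp add: zero_less_mult_iff)
  also have "\<dots> \<le> L / 2 * t * (norm (y - x))\<^sup>2 + (1 - \<beta>) * - (\<kappa> * (norm (y - x))\<^sup>2)"
    using mult_left_mono[OF H(2), of "1 - \<beta>"] \<beta> by simp
  also have "\<dots> = (L / 2 * t - (1 - \<beta>) * \<kappa>) * (norm (y - x))\<^sup>2"
    by (simp add: algebra_simps)
  finally have "0 < L / 2 * t - (1 - \<beta>) * \<kappa>" by (simp add: zero_less_mult_iff)
  then have "2 * (1 - \<beta>) * \<kappa> / L < t" using L_pos by (simp add: field_simps)
  then have "\<delta> * (2 * (1 - \<beta>) * \<kappa> / L) \<le> \<delta> * t" using \<delta> by (intro mult_left_mono) auto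
  then have "2 * \<delta> * (1 - \<beta>) * \<kappa> / L \<le> \<delta> ^ i" by (simp add: Suc t_def ac_simps)
  then show ?thesis by simp
qed simp

text \<open>The variational inequality tested at \<open>x\<close> bounds the part without metric
  term by \<open>- (1 / \<alpha> * ?Q)\<close>. The metric term with \<open>\<gamma> \<le> 1\<close>
  gives back at most half of this, and the eigenvalue bound converts the rest.\<close>

lemma prox_model_decrease:
  assumes x: "x \<in> edom f1" and \<alpha>: "0 < \<alpha>" "\<alpha> \<le> \<alpha>max" and \<mu>: "1 \<le> \<mu>"
    and D: "D \<in> spd_bounded \<mu>" and \<gamma>: "\<gamma> \<le> 1"
    and min: "is_arg_min (h_model f0 f1 \<alpha> D x 1) (\<lambda>_. True) y"
  shows "grad f0 x \<bullet> (y - x) + \<gamma> / (2 * \<alpha>) * ((y - x) \<bullet> (D *v (y - x)))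
      + real_of_ereal (f1 y) - real_of_ereal (f1 x)
    \<le> - (1 / (2 * \<alpha>max * \<mu>) * (norm (y - x))\<^sup>2)"
proof -
  let ?d = "y - x" and ?F = "\<lambda>x. real_of_ereal (f1 x)"
  let ?Q = "?d \<bullet> (D *v ?d)"
  have Q: "(norm ?d)\<^sup>2 / \<mu> \<le> ?Q" by (rule spd_bounded_quadratic_form[OF D])
  then have Q0: "0 \<le> ?Q" using \<mu> by (smt (verit) divide_nonneg_pos zero_le_power2)
  have "?F y + (- grad f0 x - (1 / \<alpha>) *\<^sub>R (D *v ?d)) \<bullet> (- ?d) \<le> ?F x"
    using arg_min_h_model_variational(2)[OF proper convex D \<alpha>(1) x min x] by simp
  then have G: "grad f0 x \<bullet> ?d + ?F y - ?F x \<le> - (1 / \<alpha> * ?Q)"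
    by (simp only: inner_minus_right inner_diff_left inner_minus_left inner_scaleR_left
        inner_commute[of "D *v ?d"])
  have "\<gamma> / (2 * \<alpha>) * ?Q \<le> 1 / (2 * \<alpha>) * ?Q"
    using \<gamma> \<alpha> Q0 by (intro mult_right_mono divide_right_mono) auto
  moreover have "1 / (2 * \<alpha>max * \<mu>) * (norm ?d)\<^sup>2 \<le> 1 / (2 * \<alpha>) * ?Q"
  proof -
    have "1 / (2 * \<alpha>max * \<mu>) * (norm ?d)\<^sup>2 = 1 / (2 * \<alpha>max) * ((norm ?d)\<^sup>2 / \<mu>)" by simp
    also have "\<dots> \<le> 1 / (2 * \<alpha>max) * ?Q"
      using \<alpha> by (intro mult_left_mono Q) auto
    also have "\<dots> \<le> 1 / (2 * \<alpha>) * ?Q"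
      using \<alpha> by (intro mult_right_mono Q0 divide_left_mono) auto
    finally show ?thesis .
  qed
  moreover have "1 / \<alpha> * ?Q = 1 / (2 * \<alpha>) * ?Q + 1 / (2 * \<alpha>) * ?Q"
    using \<alpha> by (simp add: field_simps)
  ultimately show ?thesis using G by linarith
qed

lemma vmilan_step:
  assumes x: "x \<in> edom f1" and \<alpha>: "0 < \<alpha>" "\<alpha> \<le> \<alpha>max" and \<mu>: "1 \<le> \<mu>"
    and D: "D \<in> spd_bounded \<mu>" and \<gamma>: "0 \<le> \<gamma>" "\<gamma> \<le> 1"
    and \<delta>: "0 < \<delta>" "\<delta> < 1" and \<beta>: "0 < \<beta>" "\<beta> < 1"
    and argmin: "is_arg_min (h_model f0 f1 \<alpha> D x 1) (\<lambda>_. True) y"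
    and armijo: "armijo (objective f0 f1) \<delta> \<beta> x (y - x) (h_model f0 f1 \<alpha> D x \<gamma> y) i"
    and min: "\<And>j. j < i \<Longrightarrow> \<not> armijo (objective f0 f1) \<delta> \<beta> x (y - x) (h_model f0 f1 \<alpha> D x \<gamma> y) j"
    and x': "x' = (if objective f0 f1 y < objective f0 f1 (x + \<delta> ^ i *\<^sub>R (y - x)) then y
      else x + \<delta> ^ i *\<^sub>R (y - x))"
    and \<kappa>: "\<kappa> = 1 / (2 * \<alpha>max * \<mu>)"
  shows "x' \<in> edom f1"
    and "\<beta> * min 1 (2 * \<delta> * (1 - \<beta>) * \<kappa> / L) * \<kappa> * (norm (y - x))\<^sup>2 \<le> F x - F x'"
    and "F x' \<le> F y"
    and "F y \<le> F x + L / 2 * (norm (y - x))\<^sup>2"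
    and "norm (x' - x) \<le> norm (y - x)"
proof -
  let ?F = "\<lambda>x. real_of_ereal (f1 x)"
  let ?d = "y - x" and ?t = "\<delta> ^ i"
  let ?p = "x + ?t *\<^sub>R ?d" and ?G = "grad f0 x \<bullet> (y - x) + ?F y - ?F x"
  have y: "y \<in> edom f1" by (rule arg_min_h_model_variational(1)[OF proper convex D \<alpha>(1) x argmin])
  define H where "H = grad f0 x \<bullet> ?d + \<gamma> / (2 * \<alpha>) * (?d \<bullet> (D *v ?d)) + ?F y - ?F x"
  have h: "h_model f0 f1 \<alpha> D x \<gamma> y = ereal H"
    unfolding H_def by (rule h_model_eq[OF proper D x y])
  have \<kappa>_pos: "0 < \<kappa>" using \<alpha> \<mu> by (simp add: \<kappa>)
  have H: "H \<le> - (\<kappa> * (norm ?d)\<^sup>2)"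
    unfolding H_def \<kappa> by (rule prox_model_decrease[OF x \<alpha> \<mu> D \<gamma>(2) argmin])
  have "0 \<le> ?d \<bullet> (D *v ?d)" using norm_wrt_sq[OF D, of ?d] by (metis zero_le_power2)
  then have "0 \<le> \<gamma> / (2 * \<alpha>) * (?d \<bullet> (D *v ?d))" using \<gamma> \<alpha> by simp
  \<comment> \<open>\<open>?G\<close> is the slope in the segment bound and \<open>H\<close> the one
    in the Armijo test; they differ by a nonnegative metric term.\<close>
  then have G: "?G \<le> H" by (simp add: H_def)
  have t: "0 < ?t" "?t \<le> 1" using \<delta> by (auto simp: power_le_one)
  have p: "?p \<in> edom f1" using segment_upper_bound(1)[OF x y] t by simp
  show x'_dom: "x' \<in> edom f1" using p y by (simp add: x')
  \<comment> \<open>The last step of the iteration selects the better of the proximal point and the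
    linesearch point.\<close>
  have x'_le: "F x' \<le> F y" "F x' \<le> F ?p"
    using objective_eq_F[OF y] objective_eq_F[OF p] by (auto simp: x')
  then show "F x' \<le> F y" by simp
  let ?lm = "min 1 (2 * \<delta> * (1 - \<beta>) * \<kappa> / L)"
  have lm: "?lm \<le> ?t"
    by (rule armijo_step_lower_bound[OF x y G H \<delta> \<beta> min[unfolded h]])
  have "F ?p \<le> F x + \<beta> * ?t * H"
    using armijo unfolding h armijo_iff[OF x p] .
  moreover have "\<beta> * ?t * H \<le> \<beta> * ?t * - (\<kappa> * (norm ?d)\<^sup>2)"
    using \<beta> t by (intro mult_left_mono H) simp
  moreover have "\<beta> * ?lm * (\<kappa> * (norm ?d)\<^sup>2) \<le> \<beta> * ?t * (\<kappa> * (norm ?d)\<^sup>2)"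
    using \<beta> \<kappa>_pos by (intro mult_right_mono mult_left_mono lm) simp_all
  ultimately have "\<beta> * ?lm * (\<kappa> * (norm ?d)\<^sup>2) \<le> F x - F x'"
    using x'_le(2) by simp
  then show "\<beta> * ?lm * \<kappa> * (norm ?d)\<^sup>2 \<le> F x - F x'" by (simp only: mult.assoc)
  \<comment> \<open>The segment bound for the full step; its slope \<open>?G\<close> is
    nonpositive.\<close>
  have "F y \<le> F x + ?G + L / 2 * (norm ?d)\<^sup>2"
    using segment_upper_bound(2)[OF x y, of 1] by simp
  moreover have "0 \<le> \<kappa> * (norm ?d)\<^sup>2" using \<kappa>_pos by simp
  ultimately show "F y \<le> F x + L / 2 * (norm ?d)\<^sup>2" using G H by linarith
  have "?t * norm ?d \<le> 1 * norm ?d" using t by (intro mult_right_mono) auto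
  then show "norm (x' - x) \<le> norm ?d" using t by (simp add: x')
qed

text \<open>Adding \<open>grad f0 y\<close> to the subgradient of \<open>f1\<close> from the
  optimality condition gives one of the objective. The Lipschitz condition controls the difference
  of gradients and the eigenvalue bound the metric term.\<close>

lemma prox_point_subgradient:
  assumes x: "x \<in> edom f1" and \<alpha>: "0 < \<alpha>min" "\<alpha>min \<le> \<alpha>" and \<mu>: "1 \<le> \<mu>"
    and D: "D \<in> spd_bounded \<mu>"
    and argmin: "is_arg_min (h_model f0 f1 \<alpha> D x 1) (\<lambda>_. True) y"
  shows "norm ((1 / \<alpha>) *\<^sub>R (D *v (y - x))) \<le> \<mu> / \<alpha>min * norm (y - x)"
    and "grad f0 y + (- grad f0 x - (1 / \<alpha>) *\<^sub>R (D *v (y - x)))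
      \<in> frechet_subdiff (objective f0 f1) y"
    and "norm (grad f0 y + (- grad f0 x - (1 / \<alpha>) *\<^sub>R (D *v (y - x))))
      \<le> (L + \<mu> / \<alpha>min) * norm (y - x)"
proof -
  have \<alpha>_pos: "0 < \<alpha>" using \<alpha> by simp
  note var = arg_min_h_model_variational[OF proper convex D \<alpha>_pos x argmin]
  have "norm ((1 / \<alpha>) *\<^sub>R (D *v (y - x))) = 1 / \<alpha> * norm (D *v (y - x))"
    using \<alpha>_pos by simp
  also have "\<dots> \<le> 1 / \<alpha>min * (\<mu> * norm (y - x))"
    using \<alpha> \<mu> by (intro mult_mono spd_bounded_norm_le[OF D \<mu>] divide_left_mono) auto
  finally show D_le: "norm ((1 / \<alpha>) *\<^sub>R (D *v (y - x))) \<le> \<mu> / \<alpha>min * norm (y - x)" by simp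
  show "grad f0 y + (- grad f0 x - (1 / \<alpha>) *\<^sub>R (D *v (y - x)))
      \<in> frechet_subdiff (objective f0 f1) y"
    by (rule frechet_subdiff_objective[OF proper var(1) gderiv[OF var(1)] var(2)])
  have "norm (grad f0 y - grad f0 x) \<le> L * norm (y - x)"
    using lipschitz_onD[OF lip var(1) x] by (simp add: dist_norm)
  with D_le show "norm (grad f0 y + (- grad f0 x - (1 / \<alpha>) *\<^sub>R (D *v (y - x))))
      \<le> (L + \<mu> / \<alpha>min) * norm (y - x)"
    using norm_triangle_ineq4[of "grad f0 y - grad f0 x" "(1 / \<alpha>) *\<^sub>R (D *v (y - x))"]
    by (simp add: algebra_simps)
qed

end

section \<open>Convergence of the algorithm\<close>

theorem corollary1:
  fixes f0 :: "real^'n \<Rightarrow> real"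
    and f1 :: "real^'n \<Rightarrow> ereal"
    and \<Omega>0 :: "(real^'n) set"
    and L \<alpha>min \<alpha>max \<mu> \<delta> \<beta> \<gamma> \<tau> :: real
    and x y yt d :: "nat \<Rightarrow> real^'n"
    and \<alpha> lam :: "nat \<Rightarrow> real"
    and D :: "nat \<Rightarrow> real^'n^'n"
    and i :: "nat \<Rightarrow> nat"
    and xbar :: "real^'n"
  assumes "proper_fun f1" and "econvex_fun f1" and "lsc_fun f1"
    and "open \<Omega>0" and "edom f1 \<subseteq> \<Omega>0" and "cont_differentiable_on f0 \<Omega>0"
    and "L > 0" and "L-lipschitz_on (edom f1) (grad f0)"
    and "\<exists>m::real. \<forall>z. ereal m \<le> objective f0 f1 z"
    and "kl_function (objective f0 f1)"
    and "0 < \<alpha>min" and "\<alpha>min \<le> \<alpha>max" and "1 \<le> \<mu>"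
    and "0 < \<delta>" and "\<delta> < 1" and "0 < \<beta>" and "\<beta> < 1"
    and "0 \<le> \<gamma>" and "\<gamma> \<le> 1" and "0 < \<tau>"
    and "vmilan_run f0 f1 \<alpha>min \<alpha>max \<mu> \<delta> \<beta> \<gamma> \<tau> x \<alpha> D y yt d i lam"
    and "\<forall>k. yt k = y k"
    and "\<exists>r. strict_mono r \<and> (x \<circ> r) \<longlonglongrightarrow> xbar"
  shows "((\<lambda>k. objective f0 f1 (x k)) \<longlonglongrightarrow> objective f0 f1 xbar)
    \<and> stationary_point (objective f0 f1) xbar
    \<and> (x \<longlonglongrightarrow> xbar \<and> summable (\<lambda>k. norm (x (Suc k) - x k)))"
proof -

  \<comment> \<open>Estimates along the run\<close>
  let ?f = "objective f0 f1"
  interpret smooth_plus_convex f0 f1 L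
    using assms(1,2,5,7,8) GDERIV_grad[OF assms(6)] by unfold_locales auto
  have \<alpha>min: "0 < \<alpha>min" and \<mu>: "1 \<le> \<mu>" and \<delta>: "0 < \<delta>" "\<delta> < 1" and \<beta>: "0 < \<beta>" "\<beta> < 1"
    and \<gamma>: "0 \<le> \<gamma>" "\<gamma> \<le> 1"
    using assms by auto
  have yt: "yt = y" using assms(22) by auto
  have x0: "x 0 \<in> edom f1" and \<alpha>: "\<alpha>min \<le> \<alpha> k" "\<alpha> k \<le> \<alpha>max"
    and D: "D k \<in> spd_bounded \<mu>"
    and argmin: "is_arg_min (h_model f0 f1 (\<alpha> k) (D k) (x k) 1) (\<lambda>_. True) (y k)"
    and d: "d k = y k - x k"
    and armijo: "armijo ?f \<delta> \<beta> (x k) (d k) (h_model f0 f1 (\<alpha> k) (D k) (x k) \<gamma> (y k)) (i k)"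
    and min: "j < i k \<Longrightarrow> \<not> armijo ?f \<delta> \<beta> (x k) (d k) (h_model f0 f1 (\<alpha> k) (D k) (x k) \<gamma> (y k)) j"
    and lam: "lam k = \<delta> ^ i k"
    and x_Suc: "x (Suc k) = (if ?f (y k) < ?f (x k + lam k *\<^sub>R d k) then y k else x k + lam k *\<^sub>R d k)"
    for k j
    using assms(21) unfolding vmilan_run_def Let_def yt atLeastAtMost_iff by blast+
  have \<alpha>_pos: "0 < \<alpha> k" for k using \<alpha>min \<alpha>(1)[of k] by simp
  define \<kappa> where "\<kappa> = 1 / (2 * \<alpha>max * \<mu>)"
  note step = vmilan_step[OF _ \<alpha>_pos \<alpha>(2) \<mu> D \<gamma> \<delta> \<beta> argmin armijo[unfolded d] min[unfolded d]
      x_Suc[unfolded d lam] \<kappa>_def, folded d]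
  have xdom: "x k \<in> edom f1" for k
  proof (induction k)
    case (Suc k)
    then show ?case by (rule step(1))
  qed (rule x0)
  have ydom: "y k \<in> edom f1" for k
    by (rule arg_min_h_model_variational(1)[OF proper convex D \<alpha>_pos xdom argmin])
  define a where "a = \<beta> * min 1 (2 * \<delta> * (1 - \<beta>) * \<kappa> / L) * \<kappa>"
  have "0 < \<kappa>" using \<alpha>_pos[of 0] \<alpha>(2)[of 0] \<mu> by (simp add: \<kappa>_def)
  then have a: "0 < a" using \<beta> \<delta> L_pos by (simp add: a_def)
  have decrease: "a * (norm (d k))\<^sup>2 \<le> F (x k) - F (x (Suc k))" for k
    unfolding a_def by (rule step(2)[OF xdom])
  have Fy_ge: "F (x (Suc k)) \<le> F (y k)" for k
    by (rule step(3)[OF xdom])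
  have Fy_le: "F (y k) \<le> F (x k) + L / 2 * (norm (d k))\<^sup>2" for k
    by (rule step(4)[OF xdom])
  have x_step: "norm (x (Suc k) - x k) \<le> norm (d k)" for k
    by (rule step(5)[OF xdom])

  \<comment> \<open>Convergence of the values and vanishing displacements\<close>
  obtain m where m: "\<And>z. ereal m \<le> ?f z" using assms(9) by blast
  have "m \<le> F (x k)" for k using m[of "x k"] by (simp add: objective_eq_F[OF xdom])
  moreover have "decseq (\<lambda>k. F (x k))"
  proof (rule decseq_SucI)
    fix k
    have "0 \<le> a * (norm (d k))\<^sup>2" using a by simp
    with decrease[of k] show "F (x (Suc k)) \<le> F (x k)" by linarith
  qed
  ultimately obtain fs where Fx_lim: "(\<lambda>k. F (x k)) \<longlonglongrightarrow> fs" and fs_le: "\<And>k. fs \<le> F (x k)"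
    using decseq_convergent[of "\<lambda>k. F (x k)" m] by blast
  have "(\<lambda>k. (F (x k) - F (x (Suc k))) / a) \<longlonglongrightarrow> (fs - fs) / a"
    using a by (intro tendsto_intros Fx_lim LIMSEQ_Suc) auto
  then have "(\<lambda>k. (F (x k) - F (x (Suc k))) / a) \<longlonglongrightarrow> 0" by simp
  then have d_sq: "(\<lambda>k. (norm (d k))\<^sup>2) \<longlonglongrightarrow> 0"
  proof (rule Lim_null_comparison[rotated], intro always_eventually allI)
    show "norm ((norm (d k))\<^sup>2) \<le> (F (x k) - F (x (Suc k))) / a" for k
      using decrease[of k] a by (simp add: field_simps)
  qed
  then have d_lim: "d \<longlonglongrightarrow> 0"
    using tendsto_norm_zero_cancel[of d] tendsto_real_sqrt[OF d_sq] by simp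
  \<comment> \<open>The values at the proximal points lie between \<open>F (x (Suc k))\<close> and
    \<open>F (x k) + L / 2 * (norm (d k))\<^sup>2\<close>.\<close>
  have Fy_lim: "(\<lambda>k. F (y k)) \<longlonglongrightarrow> fs"
  proof (rule tendsto_sandwich)
    show "(\<lambda>k. F (x (Suc k))) \<longlonglongrightarrow> fs" using Fx_lim by (rule LIMSEQ_Suc)
    have "(\<lambda>k. F (x k) + L / 2 * (norm (d k))\<^sup>2) \<longlonglongrightarrow> fs + L / 2 * 0"
      by (intro tendsto_intros Fx_lim d_sq)
    then show "(\<lambda>k. F (x k) + L / 2 * (norm (d k))\<^sup>2) \<longlonglongrightarrow> fs" by simp
  qed (intro always_eventually allI Fy_ge Fy_le)+

  \<comment> \<open>The function value at the limit point\<close>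
  obtain q where q: "strict_mono q" "(x \<circ> q) \<longlonglongrightarrow> xbar" using assms(23) by blast
  have xq: "(\<lambda>n. x (q n)) \<longlonglongrightarrow> xbar" using q(2) by (simp add: o_def)
  have sub: "(\<lambda>n. u (q n)) \<longlonglongrightarrow> l" if "u \<longlonglongrightarrow> l" for u :: "nat \<Rightarrow> 'z::topological_space" and l
    using LIMSEQ_subseq_LIMSEQ[OF that q(1)] by (simp add: o_def)
  have "(\<lambda>n. x (q n) + d (q n)) \<longlonglongrightarrow> xbar + 0" by (intro tendsto_add xq sub d_lim)
  then have yq: "(\<lambda>n. y (q n)) \<longlonglongrightarrow> xbar" by (simp add: d)

  have lsc: "lsc_fun ?f" and kl: "\<And>z. z \<in> dom_subdiff ?f \<Longrightarrow> kl_property ?f z"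
    using assms(10) by (auto simp: kl_function_def)
  have "(\<lambda>n. ?f (x (q n))) \<longlonglongrightarrow> ereal fs"
    using sub[OF Fx_lim] by (simp add: objective_eq_F[OF xdom])
  \<comment> \<open>Semicontinuity gives one inequality and places \<open>xbar\<close> in the
    domain; the reverse one follows from the variational inequality.\<close>
  from lsc_fun_le_lim[OF lsc xq this] have fbar_le: "?f xbar \<le> ereal fs" .
  then have "xbar \<in> edom ?f" using le_less_trans[of "?f xbar" "ereal fs" \<infinity>] by (simp add: edom_def)
  then have xbar_dom: "xbar \<in> edom f1" by (simp only: edom_objective)

  define w where "w k = - grad f0 (x k) - (1 / \<alpha> k) *\<^sub>R (D k *v d k)" for k
  note subgradient = prox_point_subgradient[OF xdom \<alpha>min \<alpha>(1) \<mu> D argmin, folded d, folded w_def]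
  have "(\<lambda>k. \<mu> / \<alpha>min * norm (d k)) \<longlonglongrightarrow> \<mu> / \<alpha>min * norm (0 :: real^'n)"
    by (intro tendsto_intros d_lim)
  then have "(\<lambda>k. \<mu> / \<alpha>min * norm (d k)) \<longlonglongrightarrow> 0" by simp
  then have Dd_lim: "(\<lambda>k. (1 / \<alpha> k) *\<^sub>R (D k *v d k)) \<longlonglongrightarrow> 0"
    by (rule Lim_null_comparison[rotated]) (intro always_eventually allI subgradient(1))
  have grad_lim: "(\<lambda>n. grad f0 (x (q n))) \<longlonglongrightarrow> grad f0 xbar"
    by (rule continuous_on_tendsto_compose[OF lipschitz_on_continuous_on[OF lip] xq xbar_dom])
      (simp add: xdom)
  have wq: "(\<lambda>n. w (q n)) \<longlonglongrightarrow> - grad f0 xbar - 0"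
    unfolding w_def by (intro tendsto_intros grad_lim sub[OF Dd_lim])
  have "isCont f0 xbar"
    using gderiv[OF xbar_dom] by (auto simp: gderiv_def intro: has_derivative_continuous)
  then have f0_lim: "(\<lambda>n. f0 (y (q n))) \<longlonglongrightarrow> f0 xbar" using yq by (rule isCont_tendsto_compose)
  \<comment> \<open>The variational inequality at \<open>y (q n)\<close> is tested at
    \<open>xbar\<close>. Since \<open>w (q n)\<close> converges and \<open>y (q n)\<close> tends to
    \<open>xbar\<close>, the inner product disappears in the limit.\<close>
  have "fs \<le> F xbar"
  proof (rule LIMSEQ_le[OF sub[OF Fy_lim]])
    have "(\<lambda>n. f0 (y (q n)) + real_of_ereal (f1 xbar) - w (q n) \<bullet> (xbar - y (q n)))
        \<longlonglongrightarrow> f0 xbar + real_of_ereal (f1 xbar) - (- grad f0 xbar - 0) \<bullet> (xbar - xbar)"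
      by (intro tendsto_intros f0_lim wq yq)
    then show "(\<lambda>n. f0 (y (q n)) + real_of_ereal (f1 xbar) - w (q n) \<bullet> (xbar - y (q n))) \<longlonglongrightarrow> F xbar"
      by (simp add: F_def)
    have "F (y k) \<le> f0 (y k) + real_of_ereal (f1 xbar) - w k \<bullet> (xbar - y k)" for k
      using arg_min_h_model_variational(2)[OF proper convex D \<alpha>_pos xdom argmin xbar_dom, of k]
      by (simp add: F_def w_def d)
    then show "\<exists>N. \<forall>n\<ge>N. F (y (q n)) \<le> f0 (y (q n)) + real_of_ereal (f1 xbar) - w (q n) \<bullet> (xbar - y (q n))"
      by blast
  qed
  then have fs: "F xbar = fs" using fbar_le by (simp add: objective_eq_F[OF xbar_dom])
  then have fbar: "?f xbar = ereal fs" by (simp add: objective_eq_F[OF xbar_dom])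
  have value_lim: "(\<lambda>k. ?f (x k)) \<longlonglongrightarrow> ?f xbar"
    using Fx_lim by (simp add: objective_eq_F[OF xdom] fbar)

  \<comment> \<open>Stationarity of the limit point\<close>
  define v where "v k = grad f0 (y k) + w k" for k
  define b where "b = L + \<mu> / \<alpha>min"
  have b: "0 < b" using L_pos \<mu> \<alpha>min by (simp add: b_def add_pos_nonneg)
  have v_sub: "v k \<in> frechet_subdiff ?f (y k)" and v_le: "norm (v k) \<le> b * norm (d k)" for k
    unfolding v_def b_def by (rule subgradient)+
  have "(\<lambda>k. b * norm (d k)) \<longlonglongrightarrow> b * norm (0 :: real^'n)" by (intro tendsto_intros d_lim)
  then have "(\<lambda>k. b * norm (d k)) \<longlonglongrightarrow> 0" by simp
  then have v_lim: "v \<longlonglongrightarrow> 0"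
    by (rule Lim_null_comparison[rotated]) (intro always_eventually allI v_le)
  have "(\<lambda>n. ?f (y (q n))) \<longlonglongrightarrow> ?f xbar"
    using sub[OF Fy_lim] by (simp add: objective_eq_F[OF ydom] fbar)
  \<comment> \<open>The witnesses are the proximal points and their subgradients along
    \<open>q\<close>; convergence of the values there rests on \<open>fs\<close> being the value at
    \<open>xbar\<close>.\<close>
  then have zero_sub: "0 \<in> limiting_subdiff ?f xbar"
    unfolding limiting_subdiff_def using xbar_dom yq sub[OF v_lim] v_sub
    by (intro CollectI conjI exI[of _ "\<lambda>n. y (q n)"] exI[of _ "\<lambda>n. v (q n)"])
      (auto simp: edom_objective)
  then have stationary: "stationary_point ?f xbar"
    using xbar_dom by (simp add: stationary_point_def edom_objective)

  \<comment> \<open>Finite length and convergence of the iterates\<close>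
  have "xbar \<in> dom_subdiff ?f" using zero_sub xbar_dom by (auto simp: dom_subdiff_def edom_objective)
  from kl[OF this] obtain \<upsilon> :: ereal and U and \<phi> :: "real \<Rightarrow> real"
    where \<upsilon>: "0 < \<upsilon>" and U: "xbar \<in> interior U"
      and \<phi>: "continuous_on {s. 0 \<le> s \<and> ereal s < \<upsilon>} \<phi>" "concave_on {s. 0 \<le> s \<and> ereal s < \<upsilon>} \<phi>"
        "\<And>s. 0 \<le> s \<Longrightarrow> ereal s < \<upsilon> \<Longrightarrow> 0 \<le> \<phi> s" "\<phi> 0 = 0"
      and \<phi>_C1: "\<phi> C1_differentiable_on {s. 0 < s \<and> ereal s < \<upsilon>}"
      and \<phi>_pos: "\<And>s. 0 < s \<Longrightarrow> ereal s < \<upsilon> \<Longrightarrow> 0 < deriv \<phi> s"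
      and kl_ineq: "\<And>z. z \<in> U \<Longrightarrow> ?f xbar < ?f z \<Longrightarrow> ?f z < ?f xbar + \<upsilon> \<Longrightarrow>
        1 \<le> ereal (deriv \<phi> (real_of_ereal (?f z - ?f xbar))) * set_edist 0 (limiting_subdiff ?f z)"
    unfolding kl_property_def by blast
  obtain \<rho> where \<rho>: "0 < \<rho>" "ball xbar \<rho> \<subseteq> U"
    using U by (meson mem_interior)
  have "summable (\<lambda>k. norm (d k))"
  \<comment> \<open>\<open>r\<close> and \<open>s\<close> are the gaps to the common limit
    \<open>fs\<close> at the iterates and at the proximal points.\<close>
  proof (rule kl_descent_summable[where x = x and d = d and a = a and b = b and q = q and xbar = xbar
        and r = "\<lambda>k. F (x k) - fs" and s = "\<lambda>k. F (y k) - fs" and \<phi> = \<phi> and \<phi>' = "deriv \<phi>"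
        and \<upsilon> = \<upsilon> and \<rho> = \<rho>])
    show "(\<phi> has_real_derivative deriv \<phi> t) (at t)" if "0 < t" "ereal t < \<upsilon>" for t
    proof -
      have "\<exists>l. (\<phi> has_real_derivative l) (at t)"
        using \<phi>_C1 that unfolding C1_differentiable_on_def
        by (auto simp: has_real_derivative_iff_has_vector_derivative)
      then show ?thesis by (simp add: DERIV_deriv_iff_field_differentiable field_differentiable_def)
    qed
    show "1 \<le> deriv \<phi> (F (y k) - fs) * (b * norm (d k))"
      if near: "norm (x k + d k - xbar) < \<rho>" and s: "0 < F (y k) - fs" "ereal (F (y k) - fs) < \<upsilon>" for k
    proof -
      have "y k \<in> U" using near \<rho>(2) by (auto simp: d dist_norm norm_minus_commute)
      moreover have fy: "?f (y k) = ereal (F (y k))" by (rule objective_eq_F[OF ydom])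
      moreover have "?f (y k) < ?f xbar + \<upsilon>"
        using s(2) by (cases \<upsilon>) (auto simp: fy fbar)
      ultimately have "1 \<le> ereal (deriv \<phi> (F (y k) - fs)) * set_edist 0 (limiting_subdiff ?f (y k))"
        using kl_ineq[of "y k"] s(1) by (simp add: fbar)
      also have "\<dots> \<le> ereal (deriv \<phi> (F (y k) - fs)) * ereal (b * norm (d k))"
      \<comment> \<open>The distance from 0 to the subdifferential is at most the norm of its
        element \<open>v k\<close>.\<close>
      proof (rule ereal_mult_left_mono)
        have "set_edist 0 (limiting_subdiff ?f (y k)) \<le> ereal (norm (v k - 0))"
          unfolding set_edist_def using v_sub frechet_subdiff_subset_limiting by (intro INF_lower) blast
        also have "\<dots> \<le> ereal (b * norm (d k))" using v_le[of k] by simp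
        finally show "set_edist 0 (limiting_subdiff ?f (y k)) \<le> ereal (b * norm (d k))" .
        show "0 \<le> ereal (deriv \<phi> (F (y k) - fs))" using \<phi>_pos[OF s] by simp
      qed
      finally show ?thesis by (simp add: one_ereal_def)
    qed
    show "(\<lambda>k. F (x k) - fs) \<longlonglongrightarrow> 0" using Fx_lim by (rule LIM_zero)
    show "(\<lambda>k. F (y k) - fs) \<longlonglongrightarrow> 0" using Fy_lim by (rule LIM_zero)
    show "0 \<le> F (x k) - fs" for k using fs_le[of k] by simp
    show "a * (norm (d k))\<^sup>2 \<le> F (x k) - fs - (F (x (Suc k)) - fs)" for k using decrease[of k] by simp
    show "F (x (Suc k)) - fs \<le> F (y k) - fs" for k using Fy_ge[of k] by simp
  qed (fact a x_step d_lim q \<upsilon> \<phi> \<rho>(1) b)+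
  then have summable: "summable (\<lambda>k. norm (x (Suc k) - x k))"
    by (rule summable_comparison_test'[where N = 0]) (simp add: x_step)
  \<comment> \<open>Absolute convergence of the increments gives a limit of the whole sequence by
    telescoping; the subsequence identifies it as \<open>xbar\<close>.\<close>
  then have "(\<lambda>k. x (Suc k) - x k) sums (\<Sum>k. x (Suc k) - x k)"
    by (rule summable_sums[OF summable_norm_cancel])
  then have "(\<lambda>n. x n - x 0) \<longlonglongrightarrow> (\<Sum>k. x (Suc k) - x k)"
    by (simp add: sums_def sum_lessThan_telescope)
  from tendsto_add[OF this tendsto_const[of "x 0"]]
  have x_lim: "x \<longlonglongrightarrow> (\<Sum>k. x (Suc k) - x k) + x 0" by simp
  from LIMSEQ_unique[OF sub[OF this] xq] have "x \<longlonglongrightarrow> xbar" using x_lim by simp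
  with value_lim stationary summable show ?thesis by blast
qed

end
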